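(* Let $K_+$ be an oriented knot diagram with a chosen positive crossing $c$, and let $K_-$ be the diagram obtained from $K_+$ by changing $c$ to a negative crossing. Let $\tilde K_+$ be the diagram obtained from $K_+$ by the Reidemeister II move near $c$ described in the context, let $\mathsf{h}:\mathcal{C}_{BN}(K_+)\to\mathcal{C}_{BN}(\tilde K_+)$ and $\tilde{\mathsf{h}}:\mathcal{C}_{BN}(\tilde K_+)\to\mathcal{C}_{BN}(K_+)$ be the associated chain homotopy equivalences, let $\mathfrak{f}:\mathcal{C}_{BN}(\tilde K_+)\to\mathcal{C}_{BN}(K_-\#H)$ and $\bar{\mathfrak{f}}:\mathcal{C}_{BN}(K_-\#H)\to\mathcal{C}_{BN}(\tilde K_+)$ be the cobordism maps of the saddle move from $\tilde K_+$ to $K_-\#H$ ($H$ the right-handed Hopf link) described in the context and of its inverse, and let $\mathsf{i}:\mathcal{C}_{BN}(K_-)\to\mathcal{C}_{BN}(K_-\#H)$ and $\mathsf{p}:\mathcal{C}_{BN}(K_-\#H)\to\mathcal{C}_{BN}(K_-)$ be the Hopf connected sum maps. Then $$f_c^+=\mathsf{p}\circ\mathfrak{f}\circ\mathsf{h}\qquad\text{and}\qquad f_c^-=\tilde{\mathsf{h}}\circ\bar{\mathfrak{f}}\circ\mathsf{i},$$ where $f_c^+:\mathcal{C}_{BN}(K_+)\to\mathcal{C}_{BN}(K_-)$ and $f_c^-:\mathcal{C}_{BN}(K_-)\to\mathcal{C}_{BN}(K_+)$ are the crossing change maps.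
   Context: **Bar-Natan complex.** Let $\mathbb{F}=\mathbb{Z}/2\mathbb{Z}$. Let $\mathbf{A}$ be the Frobenius algebra over $\mathbb{F}[h]$, free with basis $\{x_+,x_-\}$, with multiplication $m(x_+\otimes x_+)=x_+$, $m(x_-\otimes x_+)=m(x_+\otimes x_-)=x_-$, $m(x_-\otimes x_-)=hx_-$ and comultiplication $\Delta(x_+)=x_+\otimes x_-+x_-\otimes x_++hx_+\otimes x_+$, $\Delta(x_-)=x_-\otimes x_-$. Its unit is $x_+$ (cup) and its counit (cap) is $\varepsilon(x_-)=1$, $\varepsilon(x_+)=0$. Let $K$ be an oriented knot or link diagram with $n$ crossings. The $0$-resolution of a crossing is the smoothing joining the two regions swept out when the overstrand is rotated counterclockwise until it meets the understrand (for a positive crossing this is the orientation-respecting smoothing); the $1$-resolution is the other smoothing. For $v\in\{0,1\}^n$ let $K_v$ be the collection of circles obtained by the $v_i$-resolution at the $i$-th crossing. $\mathcal{C}_{BN}(K_v)$ is the free $\mathbb{F}[h]$-module generated by labelings of the circles of $K_v$ by $x_\pm$, and $\mathcal{C}_{BN}(K)=\bigoplus_v\mathcal{C}_{BN}(K_v)$. The differential $\delta$ is the sum over pairs $u\le v$ differing in one coordinate of the maps given by $m$ (merge) or $\Delta$ (split) on the circles involved and the identity on the others. Resolutions related by planar isotopy are identified. **Saddle maps.** If $L$ is obtained from $K$ by a saddle move away from the crossings, the cobordism map $\mathcal{C}_{BN}(K)\to\mathcal{C}_{BN}(L)$ is given on each $\mathcal{C}_{BN}(K_v)\to\mathcal{C}_{BN}(L_v)$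 by $m$ or $\Delta$ on the circles involved, according to whether the saddle merges or splits circles. **Basepoint maps.** For a point $p\in K$ away from the crossings, $m_p:\mathcal{C}_{BN}(K)\otimes_{\mathbb{F}[h]}\mathbf{A}\to\mathcal{C}_{BN}(K)$ multiplies the label of the circle through $p$ by the element of $\mathbf{A}$, $\Delta_p:\mathcal{C}_{BN}(K)\to\mathcal{C}_{BN}(K)\otimes_{\mathbb{F}[h]}\mathbf{A}$ applies $\Delta$ to the circle through $p$ (they are the maps of the saddles merging/splitting a small unknot $U$ at $p$), and $\mathbf{x}_p(a)=m_p(a\otimes x_-)$. **Crossing change maps.** For $i=0,1$ let $K_i$ be the $i$-resolution of $K_+$ at $c$. Then $\mathcal{C}_{BN}(K_+)=\mathcal{C}_{BN}(K_0)\oplus\mathcal{C}_{BN}(K_1)$ is the mapping cone of the saddle map $\mathcal{C}_{BN}(K_0)\to\mathcal{C}_{BN}(K_1)$, and $\mathcal{C}_{BN}(K_-)=\mathcal{C}_{BN}(K_1)\oplus\mathcal{C}_{BN}(K_0)$ is the mapping cone of the inverse saddle map $\mathcal{C}_{BN}(K_1)\to\mathcal{C}_{BN}(K_0)$ (the $0$-resolution of $K_-$ at $c$ is $K_1$). Let $p,q$ be points next to $c$, on the same strand through $c$, on opposite sides of $c$. Define $f_c^+(a_0,a_1)=((\mathbf{x}_p+\mathbf{x}_q)(a_1),a_0)$ and $f_c^-(a_1,a_0)=((\mathbf{x}_p+\mathbf{x}_q)(a_0),a_1)$, with $a_i\in\mathcal{C}_{BN}(K_i)$. **The Reidemeister II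 move.** Rotate the picture so that near $c$ the two strands $a$ (oriented upward) and $b$ (oriented downward) form a vertical two-strand twist region with the single crossing $c$, with $b$ on the left and $a$ on the right below $c$. Put $c_1=c$, and perform a Reidemeister II move on the two strands directly above $c_1$, creating crossings $c_2$ and, above it, $c_3$, with $c_2$ positive and $c_3$ negative. The result is $\tilde K_+$. For $i,j\in\{0,1\}$ let $\mathcal{C}_{BN}^{ij}(\tilde K_+)$ be the sum of the summands at vertices $v$ with $v(c_2)=i$, $v(c_3)=j$. The $(1,0)$-resolution of $(c_2,c_3)$ gives back $K_+$; the $(0,1)$-resolution is the disjoint union of the small circle in the bigon between $c_2$ and $c_3$ and the diagram obtained from $K_+$ by a saddle between its two strands directly above $c$. The components $\mathsf{h}^{ij}$ of $\mathsf{h}$ (projection to $\mathcal{C}_{BN}^{ij}(\tilde K_+)$) and $\tilde{\mathsf{h}}^{ij}$ of $\tilde{\mathsf{h}}$ (restriction to $\mathcal{C}_{BN}^{ij}(\tilde K_+)$) are: $\mathsf{h}^{00}=\mathsf{h}^{11}=0$, $\tilde{\mathsf{h}}^{00}=\tilde{\mathsf{h}}^{11}=0$, $\mathsf{h}^{10}=\tilde{\mathsf{h}}^{10}=\mathrm{id}$; $\mathsf{h}^{01}=g\otimes x_+$, where $g$ is the map of the saddle just mentioned and $x_+$ labels the small circle; and $\tilde{\mathsf{h}}^{01}$ is the map of the inverse saddle together with $\varepsilon$ on the small circle. **The saddle to $K_-\#H$.** In $\tilde K_+$, the left edge below $c_1$ and the left edge between $c_2$ and $c_3$ both belong to $b$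 and both border the region to the left of the twist region. The oriented saddle move in that region between these two edges cuts off the part of $b$ running through $c_2$ and $c_1$, which becomes a circle linking $a$ at $c_1$ and $c_2$; the rest of $b$ passes to the left of this circle and crosses $a$ only at $c_3$ in this picture. The result is a diagram of $K_-\#H$: it is the diagram $K_-$ (with $c_3$ playing the role of $c$), with a Hopf connected sum performed at a point on $a$ just below $c_3$, the Hopf crossings being $c_1,c_2$. **Hopf connected sum maps.** Let $L=K\#H$ be the diagram obtained from $K$ by adding near a point $p\in K$ a small oriented circle that meets the strand through $p$ in two positive crossings $c,c'$ (one over, one under). Let $L_{ij}$ be $L$ with $c$ $i$-resolved and $c'$ $j$-resolved. Then $L_{00}$ and $L_{11}$ are isotopic to $K\sqcup U$ with $U$ an unknot near $p$, $L_{01}$ and $L_{10}$ are isotopic to $K$, and $\mathcal{C}_{BN}(L)$ is the total complex of the square with $\mathcal{C}_{BN}(L_{00})=\mathcal{C}_{BN}(L_{11})=\mathcal{C}_{BN}(K)\otimes\mathbf{A}$, $\mathcal{C}_{BN}(L_{01})=\mathcal{C}_{BN}(L_{10})=\mathcal{C}_{BN}(K)$, with maps $m_p$ out of $L_{00}$ and $\Delta_p$ into $L_{11}$. Write elements as $(a_{00},a_{01},a_{10},a_{11})$ and $a_{ii}=a_{ii}^+\otimes x_++a_{ii}^-\otimes x_-$. Then $\mathsf{i}(a)=(\mathbf{x}_p(a)\otimes x_++a\otimes x_-,\,0,\,0,\,a\otimes x_+)$ and $\mathsf{p}(a_{00},a_{01},a_{10},a_{11})=a_{00}^-+a_{11}^++\mathbf{x}_p(a_{11}^-)+ha_{11}^-$.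 *)

theory Defs
  imports
    "HOL-Library.Z2"
    "HOL-Library.Numeral_Type"
    "HOL-Computational_Algebra.Polynomial"
    "HOL-Combinatorics.Permutations"
begin

section \<open>Oriented link diagrams\<close>

text \<open>
  A diagram is a combinatorial map. A crossing \<open>c\<close> has four darts \<open>(c, i)\<close>, \<open>i :: 4\<close>, in
  counterclockwise order; \<open>(c, i)\<close> and \<open>(c, i + 2)\<close> lie on the same strand. The involution
  \<open>joined\<close> pairs the two darts of every edge, \<open>over\<close> marks the darts of the overstrand, and
  \<open>inward\<close> the darts along which the orientation runs towards the crossing. A dart also serves as
  a point of the diagram, on its edge and next to its crossing.

  Every component passes through a crossing: circles without crossings are not represented.
\<close>

type_synonym 'c dart = "'c \<times> 4"

record 'c diagram =
  crossings :: "'c set"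
  joined :: "'c dart \<Rightarrow> 'c dart"
  over :: "'c dart \<Rightarrow> bool"
  inward :: "'c dart \<Rightarrow> bool"

definition darts :: "'c diagram \<Rightarrow> 'c dart set" where
  "darts K = crossings K \<times> UNIV"

fun turn :: "'c dart \<Rightarrow> 'c dart" where
  "turn (c, i) = (c, i + 1)"

fun opposite :: "'c dart \<Rightarrow> 'c dart" where
  "opposite (c, i) = (c, i + 2)"

text \<open>All functions to which this is applied permute the finite set \<open>D\<close>, so that the relation is
  an equivalence relation on \<open>D\<close>.\<close>

definition reach :: "'a set \<Rightarrow> ('a \<Rightarrow> 'a) set \<Rightarrow> ('a \<times> 'a) set" where
  "reach D F = {(x, y). x \<in> D \<and> (\<exists>f\<in>F. y = f x)}\<^sup>*"

text \<open>The boundary walk of a region alternates between following an edge and turning to the next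
  dart.\<close>

definition faces :: "'c diagram \<Rightarrow> 'c dart set set" where
  "faces K = darts K // reach (darts K) {turn \<circ> joined K}"

definition graph_components :: "'c diagram \<Rightarrow> 'c dart set set" where
  "graph_components K = darts K // reach (darts K) {joined K, turn}"

definition link_components :: "'c diagram \<Rightarrow> 'c dart set set" where
  "link_components K = darts K // reach (darts K) {joined K, opposite}"

text \<open>The last condition is planarity: the Euler characteristic is 2 on every connected component
  of the underlying 4-valent graph (which has twice as many edges as crossings).\<close>

definition link_diagram :: "'c diagram \<Rightarrow> bool" where
  "link_diagram K \<longleftrightarrow>
     finite (crossings K) \<and>
     joined K permutes darts K \<and>
     (\<forall>d\<in>darts K. joined K (joined K d) = d) \<and>
     (\<forall>d\<in>darts K. inward K (joined K d) \<longleftrightarrow> \<not> inward K d) \<and>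
     (\<forall>d\<in>darts K. inward K (opposite d) \<longleftrightarrow> \<not> inward K d) \<and>
     (\<forall>d\<in>darts K. over K (turn d) \<longleftrightarrow> \<not> over K d) \<and>
     card (crossings K) + card (faces K) = 2 * card (crossings K) + 2 * card (graph_components K)"

definition knot_diagram :: "'c diagram \<Rightarrow> bool" where
  "knot_diagram K \<longleftrightarrow> link_diagram K \<and> card (link_components K) = 1"

text \<open>At a positive crossing the understrand crosses the overstrand from right to left: its
  incoming dart follows the incoming dart of the overstrand counterclockwise.\<close>

definition positive_crossing :: "'c diagram \<Rightarrow> 'c \<Rightarrow> bool" where
  "positive_crossing K c \<longleftrightarrow>
     (\<exists>k. over K (c, k) \<and> inward K (c, k) \<and> inward K (c, k + 1))"


section \<open>The Bar-Natan complex\<close>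

text \<open>A vertex \<open>v\<close> of the cube is the set of the 1-resolved crossings. The two regions swept out
  by rotating the overstrand counterclockwise lie, at an overdart \<open>(c, i)\<close>, between \<open>i\<close> and
  \<open>i + 1\<close>; joining them connects \<open>(c, i)\<close> with \<open>(c, i - 1)\<close>.\<close>

definition smoothing :: "'c diagram \<Rightarrow> 'c set \<Rightarrow> 'c dart \<Rightarrow> 'c dart" where
  "smoothing K v = (\<lambda>(c, i). (c, if over K (c, i) \<longleftrightarrow> c \<in> v then i + 1 else i - 1))"

definition circle :: "'c diagram \<Rightarrow> 'c set \<Rightarrow> 'c dart \<Rightarrow> 'c dart set" where
  "circle K v d = reach (darts K) {joined K, smoothing K v} `` {d}"

datatype label = X_plus | X_minus

text \<open>A labeling of the circles of a resolution is given by the label of the circle through each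
  dart, with a fixed value at darts which do not belong to the diagram.\<close>

definition labelings :: "'c diagram \<Rightarrow> 'c set \<Rightarrow> ('c dart \<Rightarrow> label) set" where
  "labelings K v = {l. (\<forall>d\<in>darts K. \<forall>e\<in>circle K v d. l e = l d) \<and> (\<forall>d. d \<notin> darts K \<longrightarrow> l d = X_plus)}"

type_synonym 'c state = "'c set \<times> ('c dart \<Rightarrow> label)"

type_synonym 'c chain = "'c state \<Rightarrow> bit poly"

definition states :: "'c diagram \<Rightarrow> 'c state set" where
  "states K = (SIGMA v : Pow (crossings K). labelings K v)"

definition bar_natan :: "'c diagram \<Rightarrow> 'c chain set" where
  "bar_natan K = {a. \<forall>s. s \<notin> states K \<longrightarrow> a s = 0}"

text \<open>The \<open>\<F>[h]\<close>-linear map which sends a basis element \<open>s\<close> to the sum of \<open>M s t * t\<close>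
  over all \<open>t\<close>.\<close>

definition linear_map ::
  "'s set \<Rightarrow> 't set \<Rightarrow> ('s \<Rightarrow> 't \<Rightarrow> bit poly) \<Rightarrow> ('s \<Rightarrow> bit poly) \<Rightarrow> 't \<Rightarrow> bit poly" where
  "linear_map S T M a = (\<lambda>t. if t \<in> T then \<Sum>s\<in>S. a s * M s t else 0)"

definition hvar :: "bit poly" where
  "hvar = [:0, 1:]"

text \<open>\<open>mult_coeff a b c\<close> is the coefficient of \<open>c\<close> in \<open>m(a \<otimes> b)\<close>, and \<open>comult_coeff a b c\<close> that of
  \<open>b \<otimes> c\<close> in \<open>\<Delta>(a)\<close>.\<close>

fun mult_coeff :: "label \<Rightarrow> label \<Rightarrow> label \<Rightarrow> bit poly" where
  "mult_coeff X_plus b c = of_bool (c = b)"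
| "mult_coeff X_minus X_plus c = of_bool (c = X_minus)"
| "mult_coeff X_minus X_minus c = (if c = X_minus then hvar else 0)"

fun comult_coeff :: "label \<Rightarrow> label \<Rightarrow> label \<Rightarrow> bit poly" where
  "comult_coeff X_plus X_plus X_plus = hvar"
| "comult_coeff X_plus X_plus X_minus = 1"
| "comult_coeff X_plus X_minus X_plus = 1"
| "comult_coeff X_plus X_minus X_minus = 0"
| "comult_coeff X_minus b c = of_bool (b = X_minus \<and> c = X_minus)"

fun counit :: "label \<Rightarrow> bit poly" where
  "counit X_plus = 0"
| "counit X_minus = 1"

text \<open>The matrix entry of a saddle between two resolutions with common set of points \<open>X\<close>. Here \<open>C\<close>
  assigns to a point the circle through it before the saddle, \<open>d\<close> and \<open>e\<close> lie on the two arcs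
  involved before the saddle, and \<open>d'\<close> and \<open>e'\<close> on the two arcs which replace them. The circles
  through \<open>d\<close> and \<open>e\<close> are merged if they are different, and otherwise split.\<close>

definition saddle_coeff ::
  "'c dart set \<Rightarrow> ('c dart \<Rightarrow> 'c dart set) \<Rightarrow> 'c dart \<Rightarrow> 'c dart \<Rightarrow> 'c dart \<Rightarrow> 'c dart \<Rightarrow>
   ('c dart \<Rightarrow> label) \<Rightarrow> ('c dart \<Rightarrow> label) \<Rightarrow> bit poly" where
  "saddle_coeff X C d e d' e' l m =
     of_bool (\<forall>x \<in> X - C d - C e. m x = l x) *
     (if e \<notin> C d then mult_coeff (l d) (l e) (m d') else comult_coeff (l d) (m d') (m e'))"

text \<open>The darts \<open>(c, 0)\<close> and \<open>(c, 2)\<close> are on different arcs at \<open>c\<close> in both resolutions.\<close>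

definition differential :: "'c diagram \<Rightarrow> 'c chain \<Rightarrow> 'c chain" where
  "differential K = linear_map (states K) (states K)
     (\<lambda>(v, l) (w, m). \<Sum>c \<in> crossings K - v.
        if w = insert c v
        then saddle_coeff (darts K) (circle K v) (c, 0) (c, 2) (c, 0) (c, 2) l m else 0)"


section \<open>Saddles, basepoints and crossing changes\<close>

definition glue :: "'a \<Rightarrow> 'a \<Rightarrow> ('a \<Rightarrow> 'a) \<Rightarrow> 'a \<Rightarrow> 'a" where
  "glue x y f = f(x := y, y := x)"

text \<open>The saddle between the edges of \<open>d\<close> and \<open>e\<close> which joins \<open>d\<close> to \<open>e\<close>. It is a planar oriented
  saddle only if both edges border a common region and exactly one of \<open>d\<close>, \<open>e\<close> is inward.\<close>

definition saddle :: "'c dart \<Rightarrow> 'c dart \<Rightarrow> 'c diagram \<Rightarrow> 'c diagram" where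
  "saddle d e K = K\<lparr>joined := glue d e (glue (joined K d) (joined K e) (joined K))\<rparr>"

text \<open>The points \<open>d\<close> and \<open>joined K e\<close> lie on different arcs before as well as after the saddle.\<close>

definition saddle_map :: "'c diagram \<Rightarrow> 'c dart \<Rightarrow> 'c dart \<Rightarrow> 'c chain \<Rightarrow> 'c chain" where
  "saddle_map K d e = linear_map (states K) (states (saddle d e K))
     (\<lambda>(v, l) (w, m). if w = v
        then saddle_coeff (darts K) (circle K v) d (joined K e) d (joined K e) l m else 0)"

text \<open>The map \<open>a \<mapsto> m\<^sub>p(a \<otimes> b)\<close>.\<close>

definition basepoint_mult :: "'c diagram \<Rightarrow> 'c dart \<Rightarrow> label \<Rightarrow> 'c chain \<Rightarrow> 'c chain" where
  "basepoint_mult K p b = linear_map (states K) (states K)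
     (\<lambda>(v, l) (w, m). if w = v
        then of_bool (\<forall>x \<in> darts K - circle K v p. m x = l x) * mult_coeff (l p) b (m p) else 0)"

definition x_map :: "'c diagram \<Rightarrow> 'c dart \<Rightarrow> 'c chain \<Rightarrow> 'c chain" where
  "x_map K p a = basepoint_mult K p X_minus a"

definition crossing_change :: "'c \<Rightarrow> 'c diagram \<Rightarrow> 'c diagram" where
  "crossing_change c K = K\<lparr>over := (\<lambda>d. if fst d = c then \<not> over K d else over K d)\<rparr>"

text \<open>The 0-resolution at \<open>c\<close> of \<open>crossing_change c K\<close> is the 1-resolution of \<open>K\<close>, and conversely,
  with the same darts and circles. The component of the value in the former summand is
  \<open>\<x>\<^sub>p + \<x>\<^sub>q\<close> of the component of \<open>a\<close> at the 1-resolution of \<open>K\<close>; the other component is that of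
  \<open>a\<close> at the 0-resolution of \<open>K\<close>. This is \<open>f\<^sub>c\<^sup>+\<close> if \<open>c\<close> is positive in \<open>K\<close>, and \<open>f\<^sub>c\<^sup>-\<close> if \<open>c\<close> is
  negative.\<close>

definition crossing_change_map ::
  "'c diagram \<Rightarrow> 'c \<Rightarrow> 'c dart \<Rightarrow> 'c dart \<Rightarrow> 'c chain \<Rightarrow> 'c chain" where
  "crossing_change_map K c p q a =
     (\<lambda>(v, l). if c \<in> v then a (v - {c}, l)
               else x_map K p a (insert c v, l) + x_map K q a (insert c v, l))"


section \<open>The Reidemeister II move\<close>

text \<open>
  Here \<open>k\<close> is the position at which the overstrand enters the positive crossing \<open>c\<close>. In the rotated
  picture the overstrand is \<open>a\<close>, and the positions \<open>k\<close>, \<open>k + 1\<close>, \<open>k + 2\<close>, \<open>k + 3\<close> point south-east,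
  north-east, north-west and south-west; the positions at the new crossings are numbered in the
  same way. The strand \<open>b\<close> passes over \<open>a\<close> at \<open>c2\<close> (from north-west to south-east) and at \<open>c3\<close>
  (from north-east to south-west). The edges which left \<open>c\<close> upwards now leave \<open>c3\<close> upwards (these two
  may be the same edge).
\<close>

definition r2_diagram :: "'c diagram \<Rightarrow> 'c \<Rightarrow> 4 \<Rightarrow> 'c \<Rightarrow> 'c \<Rightarrow> 'c diagram" where
  "r2_diagram K c k c2 c3 =
     (let up = transpose (c, k + 1) (c3, k + 1) \<circ> transpose (c, k + 2) (c3, k + 2) in
      \<lparr>crossings = crossings K \<union> {c2, c3},
       joined = glue (c, k + 2) (c2, k + 3) (glue (c, k + 1) (c2, k)
         (glue (c2, k + 2) (c3, k + 3) (glue (c2, k + 1) (c3, k) (up \<circ> joined K \<circ> up)))),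
       over = (\<lambda>(x, i). if x = c2 then i \<in> {k, k + 2} else if x = c3 then i \<in> {k + 1, k + 3}
                 else over K (x, i)),
       inward = (\<lambda>(x, i). if x = c2 then i \<in> {k + 2, k + 3} else if x = c3 then i \<in> {k, k + 1}
                 else inward K (x, i))\<rparr>)"

definition restrict_labeling :: "'c diagram \<Rightarrow> ('c dart \<Rightarrow> label) \<Rightarrow> 'c dart \<Rightarrow> label" where
  "restrict_labeling K l = (\<lambda>d. if d \<in> darts K then l d else X_plus)"

text \<open>
  At the \<open>(1,0)\<close>-resolution of \<open>(c2, c3)\<close> the circles are identified with those of the original
  diagram by means of the old darts. At the \<open>(0,1)\<close>-resolution, \<open>(c2, k + 2)\<close> lies on the small
  circle, and the two arcs of the saddle directly above \<open>c\<close> pass through \<open>(c, k + 2)\<close> and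
  \<open>(c, k + 1)\<close> in the original diagram, and through \<open>(c, k + 2)\<close> (lower arc) and \<open>(c3, k + 2)\<close>
  (upper arc) afterwards.
\<close>

definition r2_map :: "'c diagram \<Rightarrow> 'c \<Rightarrow> 4 \<Rightarrow> 'c \<Rightarrow> 'c \<Rightarrow> 'c chain \<Rightarrow> 'c chain" where
  "r2_map K c k c2 c3 = linear_map (states K) (states (r2_diagram K c k c2 c3))
     (\<lambda>(v, l) (w, m).
        if w = insert c2 v then of_bool (restrict_labeling K m = l)
        else if w = insert c3 v then
          of_bool (m (c2, k + 2) = X_plus) *
          saddle_coeff (darts K) (circle K v) (c, k + 2) (c, k + 1) (c, k + 2) (c3, k + 2) l m
        else 0)"

definition r2_inverse_map :: "'c diagram \<Rightarrow> 'c \<Rightarrow> 4 \<Rightarrow> 'c \<Rightarrow> 'c \<Rightarrow> 'c chain \<Rightarrow> 'c chain" where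
  "r2_inverse_map K c k c2 c3 = linear_map (states (r2_diagram K c k c2 c3)) (states K)
     (\<lambda>(w, m) (v, l).
        if w = insert c2 v then of_bool (restrict_labeling K m = l)
        else if w = insert c3 v then
          counit (m (c2, k + 2)) *
          saddle_coeff (darts K) (circle (r2_diagram K c k c2 c3) w)
            (c, k + 2) (c3, k + 2) (c, k + 2) (c, k + 1) m l
        else 0)"


section \<open>Hopf connected sums\<close>

text \<open>
  The connected sum is performed just before the inward dart \<open>d\<close>, at the end of the edge from
  \<open>joined K d\<close> to \<open>d\<close>. Draw this strand vertically, oriented upward: it first passes over the new
  circle at \<open>c\<close> and then under it at \<open>c'\<close>. As above, with \<open>k = snd d\<close>, the positions \<open>k\<close>,
  \<open>k + 1\<close>, \<open>k + 2\<close>, \<open>k + 3\<close> at \<open>c\<close> and \<open>c'\<close> point south-east, north-east, north-west and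
  south-west; the strand of the original diagram runs from south-east to north-west at \<open>c\<close> and from
  south-west to north-east at \<open>c'\<close>.
\<close>

definition hopf_sum :: "'c diagram \<Rightarrow> 'c dart \<Rightarrow> 'c \<Rightarrow> 'c \<Rightarrow> 'c diagram" where
  "hopf_sum K d c c' =
     (let k = snd d in
      \<lparr>crossings = crossings K \<union> {c, c'},
       joined = glue (joined K d) (c, k) (glue (c, k + 2) (c', k + 3) (glue (c, k + 1) (c', k)
         (glue (c, k + 3) (c', k + 2) (glue (c', k + 1) d (joined K))))),
       over = (\<lambda>(x, i). if x = c \<or> x = c' then i \<in> {k, k + 2} else over K (x, i)),
       inward = (\<lambda>(x, i). if x = c then i \<in> {k, k + 1} else if x = c' then i \<in> {k + 2, k + 3}
                 else inward K (x, i))\<rparr>)"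

text \<open>
  For \<open>V = {}\<close> and \<open>V = {c, c'}\<close>, the resolutions \<open>L\<^sub>0\<^sub>0\<close> and \<open>L\<^sub>1\<^sub>1\<close> consist of the small circle,
  which contains \<open>(c, k + 2)\<close> in both cases, and of circles identified with those of \<open>K\<close> by means
  of the darts of \<open>K\<close>. The first map is \<open>a \<mapsto> a \<otimes> e\<close> into the summand of \<open>V\<close>, the second one
  takes the coefficient of \<open>e\<close> of the component in this summand.
\<close>

definition hopf_incl ::
  "'c diagram \<Rightarrow> 'c dart \<Rightarrow> 'c \<Rightarrow> 'c \<Rightarrow> 'c set \<Rightarrow> label \<Rightarrow> 'c chain \<Rightarrow> 'c chain" where
  "hopf_incl K d c c' V e = linear_map (states K) (states (hopf_sum K d c c'))
     (\<lambda>(v, l) (w, m). of_bool (w = v \<union> V \<and> restrict_labeling K m = l \<and> m (c, snd d + 2) = e))"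

definition hopf_component ::
  "'c diagram \<Rightarrow> 'c dart \<Rightarrow> 'c \<Rightarrow> 'c \<Rightarrow> 'c set \<Rightarrow> label \<Rightarrow> 'c chain \<Rightarrow> 'c chain" where
  "hopf_component K d c c' V e = linear_map (states (hopf_sum K d c c')) (states K)
     (\<lambda>(w, m) (v, l). of_bool (w = v \<union> V \<and> restrict_labeling K m = l \<and> m (c, snd d + 2) = e))"

definition hopf_i :: "'c diagram \<Rightarrow> 'c dart \<Rightarrow> 'c \<Rightarrow> 'c \<Rightarrow> 'c chain \<Rightarrow> 'c chain" where
  "hopf_i K d c c' a = (\<lambda>s.
     hopf_incl K d c c' {} X_plus (x_map K d a) s +
     hopf_incl K d c c' {} X_minus a s +
     hopf_incl K d c c' {c, c'} X_plus a s)"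

definition hopf_p :: "'c diagram \<Rightarrow> 'c dart \<Rightarrow> 'c \<Rightarrow> 'c \<Rightarrow> 'c chain \<Rightarrow> 'c chain" where
  "hopf_p K d c c' a = (\<lambda>s.
     hopf_component K d c c' {} X_minus a s +
     hopf_component K d c c' {c, c'} X_plus a s +
     x_map K d (hopf_component K d c c' {c, c'} X_minus a) s +
     hvar * hopf_component K d c c' {c, c'} X_minus a s)"


section \<open>The diagram of the connected sum after the saddle\<close>

definition rename_dart :: "'c \<Rightarrow> 'c \<Rightarrow> 'c dart \<Rightarrow> 'c dart" where
  "rename_dart c c' = map_prod (transpose c c') id"

text \<open>Exchange the names \<open>c\<close> and \<open>c'\<close>.\<close>

definition rename_diagram :: "'c \<Rightarrow> 'c \<Rightarrow> 'c diagram \<Rightarrow> 'c diagram" where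
  "rename_diagram c c' K =
     \<lparr>crossings = transpose c c' ` crossings K,
      joined = rename_dart c c' \<circ> joined K \<circ> rename_dart c c',
      over = over K \<circ> rename_dart c c',
      inward = inward K \<circ> rename_dart c c'\<rparr>"

definition rename_chain :: "'c \<Rightarrow> 'c \<Rightarrow> 'c chain \<Rightarrow> 'c chain" where
  "rename_chain c c' a = (\<lambda>(v, l). a (transpose c c' ` v, l \<circ> rename_dart c c'))"

text \<open>
  The oriented saddle to the left of the twist region, between the edge at \<open>(c, k + 3)\<close> and the
  edge from \<open>(c2, k + 2)\<close> to \<open>(c3, k + 3)\<close>, joins \<open>(c, k + 3)\<close> to \<open>(c2, k + 2)\<close>. Its result is the
  Hopf connected sum of the diagram with \<open>c\<close> changed and renamed to \<open>c3\<close>, performed just before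
  \<open>a\<close> enters \<open>c3\<close>. Thus the maps of the saddle and of the connected sum can be composed.
\<close>

lemma four_cases: "i = k \<or> i = k + 1 \<or> i = k + 2 \<or> i = k + (3::4)"
proof -
  have "(UNIV::4 set) = {0,1,2,3}"
    apply (rule sym, rule card_subset_eq) by simp_all
  hence "i - k \<in> {0,1,2,3}" by (metis UNIV_I)
  thus ?thesis by (auto simp: algebra_simps)
qed

lemma saddle_r2_diagram_eq_hopf_sum:
  assumes D: "link_diagram K" and c: "c \<in> crossings K" "over K (c, k)" "inward K (c, k)"
    "inward K (c, k + 1)"
    and new: "c2 \<notin> crossings K" "c3 \<notin> crossings K" "c2 \<noteq> c3"
  shows "saddle (c, k + 3) (c2, k + 2) (r2_diagram K c k c2 c3) =
    hopf_sum (rename_diagram c c3 (crossing_change c K)) (c3, k) c c2" (is "?L = ?R")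
proof -
  have ne [simp]: "c \<noteq> c2" "c \<noteq> c3" "c2 \<noteq> c" "c3 \<noteq> c" "c3 \<noteq> c2" "c2 \<noteq> c3" using c new by auto
  let ?s = "joined K"
  note [simp] = new(1,2)
  have perm: "?s permutes darts K" and inv0: "\<And>d. d \<in> darts K \<Longrightarrow> ?s (?s d) = d"
    and inw: "\<And>d. d \<in> darts K \<Longrightarrow> inward K (?s d) = (\<not> inward K d)"
    and opp: "\<And>d. d \<in> darts K \<Longrightarrow> inward K (opposite d) = (\<not> inward K d)"
    and ov: "\<And>d. d \<in> darts K \<Longrightarrow> over K (turn d) = (\<not> over K d)"
    using D by (auto simp: link_diagram_def)
  have cd [simp]: "(c, i) \<in> darts K" for i using c by (simp add: darts_def)
  have ncd [simp]: "(c2, i) \<notin> darts K" "(c3, i) \<notin> darts K" for i using new by (auto simp: darts_def)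
  have inv: "?s (?s d) = d" for d using perm inv0 by (metis permutes_not_in)
  have inj: "?s x = ?s y \<longleftrightarrow> x = y" for x y by (metis inv)
  have fix' [simp]: "?s (c2, i) = (c2, i)" "?s (c3, i) = (c3, i)" for i
    using perm by (auto intro: permutes_not_in)
  have nin: "?s d \<noteq> (c2, i)" "?s d \<noteq> (c3, i)" if "fst d \<notin> {c2, c3}" for d i
    using that inv by (metis fix' fst_conv insertI1 insert_commute)+
  have in23: "\<not> inward K (c, k + 2)" "\<not> inward K (c, k + 3)"
    using opp[of "(c, k)"] opp[of "(c, k + 1)"] c by (auto simp: add.assoc)
  have sc: "?s (c, i) \<noteq> (c, j)" if "inward K (c, i) = inward K (c, j)" for i j
    using inw[of "(c, i)"] that by auto
  have ov': "over K (c, k + 1) = False" "over K (c, k + 2) = True" "over K (c, k + 3) = False"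
    using ov[of "(c, k)"] ov[of "(c, k + 1)"] ov[of "(c, k + 2)"] c by (auto simp: add.assoc)
  have 1: "crossings ?L = crossings ?R"
    using c new by (auto simp: saddle_def r2_diagram_def hopf_sum_def rename_diagram_def
        crossing_change_def Let_def transpose_def image_iff)
  have 2: "over ?L = over ?R"
  proof
    fix d show "over ?L d = over ?R d"
    proof (cases d)
      case (Pair x i)
      then show ?thesis using four_cases[of i k] c ov'
        by (auto simp: saddle_def r2_diagram_def hopf_sum_def rename_diagram_def rename_dart_def
          crossing_change_def Let_def transpose_def)
    qed
  qed
  have 3: "inward ?L = inward ?R"
  proof
    fix d show "inward ?L d = inward ?R d"
    proof (cases d)
      case (Pair x i)
      then show ?thesis using four_cases[of i k] c in23
        by (auto simp: saddle_def r2_diagram_def hopf_sum_def rename_diagram_def rename_dart_def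
          crossing_change_def Let_def transpose_def)
    qed
  qed
  define up where "up = transpose (c, k + 1) (c3, k + 1) \<circ> transpose (c, k + 2) (c3, k + 2)"
  define t where "t = rename_dart c c3"
  have up: "up d = (if d = (c, k + 1) then (c3, k + 1) else if d = (c3, k + 1) then (c, k + 1)
      else if d = (c, k + 2) then (c3, k + 2) else if d = (c3, k + 2) then (c, k + 2) else d)" for d
    by (auto simp: up_def transpose_def)
  have t: "t (x, i) = (if x = c then (c3, i) else if x = c3 then (c, i) else (x, i))" for x i
    by (auto simp: t_def rename_dart_def transpose_def)
  define y where "y = ?s (c, k + 3)"
  define z where "z = ?s (c, k)"
  have y: "y \<noteq> (c, k + 2)" "y \<noteq> (c, k + 3)" "y \<noteq> (c2, i)" "y \<noteq> (c3, i)" for i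
    using sc[of "k+3" "k+2"] sc[of "k+3" "k+3"] in23 nin[of "(c, k + 3)"] by (auto simp: y_def)
  have z: "z \<noteq> (c, k)" "z \<noteq> (c, k + 1)" "z \<noteq> (c2, i)" "z \<noteq> (c3, i)" for i
    using sc[of "k" "k"] sc[of "k" "k+1"] c nin[of "(c, k)"] by (auto simp: z_def)
  have yi: "?s d = (c, k + 3) \<longleftrightarrow> d = y" for d using inv unfolding y_def by metis
  have zi: "?s d = (c, k) \<longleftrightarrow> d = z" for d using inv unfolding z_def by metis
  have uy: "joined (r2_diagram K c k c2 c3) (c, k + 3) = up y"
    "joined (r2_diagram K c k c2 c3) (c2, k + 2) = (c3, k + 3)"
    by (auto simp: r2_diagram_def Let_def glue_def up_def[symmetric] y_def up)
  have L: "joined ?L = glue (c, k + 3) (c2, k + 2) (glue (up y) (c3, k + 3)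
     (glue (c, k + 2) (c2, k + 3) (glue (c, k + 1) (c2, k)
         (glue (c2, k + 2) (c3, k + 3) (glue (c2, k + 1) (c3, k) (up \<circ> joined K \<circ> up))))))"
    unfolding saddle_def uy by (simp add: r2_diagram_def Let_def up_def o_assoc)
  have R: "joined ?R = glue (t z) (c, k) (glue (c, k + 2) (c2, k + 3) (glue (c, k + 1) (c2, k)
     (glue (c, k + 3) (c2, k + 2) (glue (c2, k + 1) (c3, k) (t \<circ> joined K \<circ> t)))))"
    by (simp add: hopf_sum_def Let_def rename_diagram_def crossing_change_def t_def[symmetric] t z_def)
  have tr: "?s d = (c, k + 3) \<or> ?s d = (c, k) \<or> up (?s d) = t (?s d)"
    if "fst d \<noteq> c2" "fst d \<noteq> c3" for d
    using nin[of d] that four_cases[of "snd (?s d)" k] 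
    by (cases "?s d") (auto simp: up t)
  have upy: "up y = (if y = (c, k + 1) then (c3, k + 1) else y)"
    using y by (auto simp: up)
  have tz: "t z = (if fst z = c then (c3, snd z) else z)"
    using z by (cases z) (auto simp: t)
  have zn: "fst z \<noteq> c2" "fst z \<noteq> c3" using z by (metis prod.collapse)+
  have yz: "y = (c, k) \<longleftrightarrow> z = (c, k + 3)" using inv unfolding y_def z_def by metis
  have 4: "joined ?L = joined ?R"
  proof
    fix d show "joined ?L d = joined ?R d"
    proof (cases d)
      case (Pair x i)
      note gl = L R glue_def upy tz up t
      obtain z1 z2 where z12: "z = (z1, z2)" by (cases z)
      note z' = z[unfolded z12] yz[unfolded z12]
      have i: "i = k \<or> i = k + 1 \<or> i = k + 2 \<or> i = k + 3" by (rule four_cases)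
      consider "x = c" | "x = c2" | "x = c3" | "x \<noteq> c" "x \<noteq> c2" "x \<noteq> c3" by blast
      then show ?thesis
      proof cases
        case 1
        have upk: "up (c, k) = (c, k)" by (auto simp: up)
        have upyi: "(c, k) = up y \<longleftrightarrow> y = (c, k)" "(c, k + 1) \<noteq> up y" "(c, k + 2) \<noteq> up y"
          using y by (auto simp: upy)
        have tzi: "(c, j) \<noteq> t z" for j using z zn by (auto simp: tz prod_eq_iff)
        have "joined ?L (c, k) = (if y = (c, k) then (c3, k + 3) else up z)"
          by (simp add: L glue_def upyi upk z_def)
        moreover have "joined ?R (c, k) = t z"
          by (simp add: R glue_def tzi)
        moreover have "up z = t z" if "z \<noteq> (c, k + 3)"
          using z that four_cases[of "snd z" k] by (cases z) (auto simp: up t)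
        ultimately have a: "joined ?L (c, k) = joined ?R (c, k)"
          using yz by (auto simp: t)
        have b: "joined ?L (c, k + 1) = joined ?R (c, k + 1)"
          by (simp add: L R glue_def tzi upyi)
        have cc: "joined ?L (c, k + 2) = joined ?R (c, k + 2)"
          by (simp add: L R glue_def tzi upyi)
        have d: "joined ?L (c, k + 3) = joined ?R (c, k + 3)"
          by (simp add: L R glue_def tzi upyi)
        show ?thesis using a b cc d i 1 Pair by auto
      next
        case 2
        have upyi: "(c2, j) \<noteq> up y" for j using y by (auto simp: upy)
        have tzi: "(c2, j) \<noteq> t z" for j using z zn by (auto simp: tz prod_eq_iff)
        have a: "joined ?L (c2, k) = joined ?R (c2, k)"
          by (simp add: L R glue_def tzi upyi)
        have b: "joined ?L (c2, k + 1) = joined ?R (c2, k + 1)"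
          by (simp add: L R glue_def tzi upyi)
        have cc: "joined ?L (c2, k + 2) = joined ?R (c2, k + 2)"
          by (simp add: L R glue_def tzi upyi)
        have d: "joined ?L (c2, k + 3) = joined ?R (c2, k + 3)"
          by (simp add: L R glue_def tzi upyi)
        show ?thesis using a b cc d i 2 Pair by auto
      next
        case 3
        have upi: "up (c3, k + 1) = (c, k + 1)" "up (c3, k + 2) = (c, k + 2)" by (auto simp: up)
        have ti: "t (c3, j) = (c, j)" for j by (auto simp: t)
        have upyi: "(c3, j) = up y \<longleftrightarrow> j = k + 1 \<and> y = (c, k + 1)" for j using y by (auto simp: upy)
        have tzi: "(c3, j) = t z \<longleftrightarrow> z = (c, j)" for j using z zn by (auto simp: tz prod_eq_iff)
        have ut: "up (?s (c, j)) = t (?s (c, j))" if "(c, j) \<noteq> y" "(c, j) \<noteq> z" for j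
          using tr[of "(c, j)"] that yi zi by auto
        have a: "joined ?L (c3, k) = joined ?R (c3, k)"
          using z by (simp add: L R glue_def upyi tzi)
        have "joined ?L (c3, k + 1) = (if y = (c, k + 1) then (c3, k + 3) else up (?s (c, k + 1)))"
          by (simp add: L glue_def upyi upi)
        moreover have "joined ?R (c3, k + 1) = t (?s (c, k + 1))"
          using z by (simp add: R glue_def tzi ti)
        moreover have "t (?s y) = (c3, k + 3)" using inv unfolding y_def by (simp add: t)
        ultimately have b: "joined ?L (c3, k + 1) = joined ?R (c3, k + 1)"
          using ut[of "k + 1"] z by auto
        have "joined ?L (c3, k + 2) = up (?s (c, k + 2))"
          by (simp add: L glue_def upyi upi)
        moreover have "joined ?R (c3, k + 2) = (if z = (c, k + 2) then (c, k) else t (?s (c, k + 2)))"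
          using z by (simp add: R glue_def tzi ti)
        moreover have "up (?s z) = (c, k)" using inv unfolding z_def by (simp add: up)
        ultimately have cc: "joined ?L (c3, k + 2) = joined ?R (c3, k + 2)"
          using ut[of "k + 2"] y by auto
        have "joined ?L (c3, k + 3) = up y"
          by (simp add: L glue_def upyi upi)
        moreover have "joined ?R (c3, k + 3) = (if z = (c, k + 3) then (c, k) else t y)"
          using z by (simp add: R glue_def tzi ti y_def)
        moreover have "up y = t y" if "y \<noteq> (c, k)"
          using y that four_cases[of "snd y" k] by (cases y) (auto simp: up t)
        ultimately have d: "joined ?L (c3, k + 3) = joined ?R (c3, k + 3)"
          using yz by (auto simp: up)
        show ?thesis using a b cc d i 3 Pair by auto
      next
        case 4
        have dn: "d \<noteq> (c, j)" "d \<noteq> (c2, j)" "d \<noteq> (c3, j)" for j using 4 Pair by auto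
        have ud: "up d = d" "t d = d" using 4 Pair by (auto simp: up t)
        have upyi: "d = up y \<longleftrightarrow> d = y" "d = t z \<longleftrightarrow> d = z"
          using 4 Pair by (auto simp: upy tz)
        have "joined ?L d = (if d = y then (c3, k + 3) else up (?s d))"
          by (simp add: L glue_def upyi ud dn)
        moreover have "joined ?R d = (if d = z then (c, k) else t (?s d))"
          by (simp add: R glue_def upyi ud dn)
        moreover have "t (?s y) = (c3, k + 3)" "up (?s z) = (c, k)"
          using inv unfolding y_def z_def by (simp_all add: t up)
        moreover have "up (?s d) = t (?s d)" if "d \<noteq> y" "d \<noteq> z"
          using tr[of d] that 4 Pair yi zi by auto
        moreover have "y \<noteq> z" by (simp add: y_def z_def inj)
        ultimately show ?thesis by auto
      qed
    qed
  qed
  show ?thesis using 1 2 3 4 by simp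
qed

text \<open>The inverse of \<open>saddle d e\<close> is the saddle which joins \<open>d\<close> to its former partner.\<close>

lemma saddle_saddle:
  assumes "joined K (joined K d) = d" "joined K (joined K e) = e" "distinct [d, e, joined K d, joined K e]"
  shows "saddle d (joined K d) (saddle d e K) = K"
  using assms by (auto simp: saddle_def glue_def fun_eq_iff)

end

theory Submission
  imports Defs
begin

text \<open>
  The identities are local. On a summand of \<open>\<C>\<^sub>B\<^sub>N(K\<^sub>+)\<close> where \<open>c\<close> is 0-resolved (two horizontal
  arcs), the Reidemeister map splits off a circle between \<open>c\<close> and \<open>c\<^sub>2\<close>, the saddle merges the circle
  labelled \<open>x\<^sub>+\<close> between \<open>c\<^sub>2\<close> and \<open>c\<^sub>3\<close> into the lower arc, and \<open>\<p>\<close> takes the coefficient of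
  \<open>x\<^sub>-\<close> on the first circle; this gives the identity, since \<open>(\<epsilon> \<otimes> id) \<Delta> = id\<close>. Where \<open>c\<close> is
  1-resolved (two vertical arcs), the saddle splits a circle off the left arc, and applying \<open>\<p>\<close> to
  \<open>\<Delta>(x\<^sub>+)\<close> and \<open>\<Delta>(x\<^sub>-)\<close> gives the sum of the actions of \<open>x\<^sub>-\<close> on the left and on the right arc.
  The second identity is dual to this. Each saddle merges or cuts off a circle which runs only
  through \<open>c\<close>, \<open>c\<^sub>2\<close> and \<open>c\<^sub>3\<close>, so that its type does not depend on the rest of the diagram.

  A labeling of a resolution is a function on the darts which is invariant under \<open>joined\<close> and
  \<open>smoothing\<close>. Hence the labelings of the resolutions which contribute are described explicitly by
  labelings of resolutions of \<open>K\<close>, and the sums defining the maps are evaluated at these.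
\<close>

section \<open>Positions modulo 4, structure coefficients, and sums with small support\<close>

lemma four_simps [simp]:
  fixes i :: 4
  shows "i + 1 + 1 = i + 2" "i + 1 + 2 = i + 3" "i + 1 + 3 = i" "i + 2 + 1 = i + 3" "i + 2 + 2 = i"
    "i + 2 + 3 = i + 1" "i + 3 + 1 = i" "i + 3 + 2 = i + 1" "i + 3 + 3 = i + 2"
    "i + 1 - 1 = i" "i + 2 - 1 = i + 1" "i + 3 - 1 = i + 2"
  by (simp_all add: add.assoc diff_add_eq[symmetric])

lemma minus_one_four: "(i :: 4) - 1 = i + 3"
  by (simp add: diff_eq_eq)

lemma all_four: "(\<forall>i. P (i :: 4)) \<longleftrightarrow> P k \<and> P (k + 1) \<and> P (k + 2) \<and> P (k + 3)"
  using four_cases by metis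

lemma UNIV_label: "UNIV = {X_plus, X_minus}"
  using label.exhaust by auto

lemma sum_label: "sum f UNIV = f X_plus + f X_minus"
  by (simp add: UNIV_label)

lemma label_neq [simp]: "l \<noteq> X_plus \<longleftrightarrow> l = X_minus" "l \<noteq> X_minus \<longleftrightarrow> l = X_plus"
  by (cases l; simp)+

lemma mult_coeff_X_plus [simp]: "mult_coeff b X_plus c = of_bool (c = b)"
  by (cases b) auto

lemma comult_coeff_X_minus [simp]:
  "comult_coeff a X_minus b = of_bool (a = b)" "comult_coeff a b X_minus = of_bool (a = b)"
  by (cases a; cases b; simp)+

text \<open>Characteristic 2 cancels the two terms with \<open>hvar\<close> that arise when
  \<open>hopf_p\<close> meets the comultiplication of \<open>x_+\<close>.\<close>

lemma add_self_bit_poly: "(a :: bit poly) + a = 0"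
proof (rule poly_eqI)
  fix n show "coeff (a + a) n = coeff 0 n"
    unfolding coeff_add by (cases "coeff a n") (simp_all only: coeff_0, simp_all)
qed

text \<open>The matrix sums below are evaluated by this reindexing: \<open>g\<close> parametrizes
  the states that contribute.\<close>

lemma sum_support:
  assumes "finite A" "inj_on g I" "g ` I \<subseteq> A" "\<And>y. y \<in> A \<Longrightarrow> y \<notin> g ` I \<Longrightarrow> f y = 0"
  shows "sum f A = (\<Sum>i\<in>I. f (g i))"
proof -
  have "sum f A = sum f (g ` I)"
    using assms by (intro sum.mono_neutral_right) auto
  then show ?thesis using assms(2) by (simp add: sum.reindex)
qed

lemma sum_single:
  assumes "finite A" "x \<in> A" "\<And>y. y \<in> A \<Longrightarrow> y \<noteq> x \<Longrightarrow> f y = 0"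
  shows "sum f A = f x"
  using sum_support[of A "\<lambda>_. x" "{()}" f] assms by auto


section \<open>Circles and labelings\<close>

lemma circle_self: "d \<in> circle K v d"
  by (simp add: circle_def reach_def)

lemma circle_step:
  assumes "x \<in> circle K v d" "x \<in> darts K"
  shows "joined K x \<in> circle K v d" "smoothing K v x \<in> circle K v d"
  using assms unfolding circle_def reach_def
  by (auto intro: rtrancl_into_rtrancl)

lemma circle_subset:
  assumes "d \<in> S" "\<And>x. x \<in> S \<Longrightarrow> x \<in> darts K \<Longrightarrow> joined K x \<in> S \<and> smoothing K v x \<in> S"
  shows "circle K v d \<subseteq> S"
proof
  fix x assume "x \<in> circle K v d"
  then have "(d, x) \<in> {(x, y). x \<in> darts K \<and> (\<exists>f\<in>{joined K, smoothing K v}. y = f x)}\<^sup>*"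
    by (simp add: circle_def reach_def)
  then show "x \<in> S"
    by (induction rule: rtrancl_induct) (use assms in auto)
qed

text \<open>Circles are generated by edges and smoothing arcs, so constancy can be tested one step
  at a time. This turns membership into local conditions, without knowledge of the circles.\<close>

lemma labelings_iff:
  "l \<in> labelings K v \<longleftrightarrow>
     (\<forall>d\<in>darts K. l (joined K d) = l d) \<and>
     (\<forall>x\<in>crossings K. \<forall>i. l (smoothing K v (x, i)) = l (x, i)) \<and>
     (\<forall>d. d \<notin> darts K \<longrightarrow> l d = X_plus)" (is "_ \<longleftrightarrow> ?R")
proof
  assume l: "l \<in> labelings K v"
  then show ?R
    using circle_step[OF circle_self] by (fastforce simp: labelings_def darts_def)
next
  assume R: ?R
  have "circle K v d \<subseteq> {x. l x = l d}" if "d \<in> darts K" for d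
    using R that by (intro circle_subset) (auto simp: darts_def)
  with R show "l \<in> labelings K v"
    by (auto simp: labelings_def)
qed

lemma X_plus_labelings: "(\<lambda>_. X_plus) \<in> labelings K v"
  by (simp add: labelings_iff)

lemma labelings_circle: "l \<in> labelings K v \<Longrightarrow> d \<in> darts K \<Longrightarrow> e \<in> circle K v d \<Longrightarrow> l e = l d"
  by (simp add: labelings_def)

lemma labelings_outside: "l \<in> labelings K v \<Longrightarrow> d \<notin> darts K \<Longrightarrow> l d = X_plus"
  unfolding labelings_def by blast

text \<open>One dart determines the label of its whole circle. With \<open>d\<close> and
  \<open>e\<close> at the feet of a saddle, this pins down the source labeling of a given
  target.\<close>

lemma labeling_eqI:
  assumes "l \<in> labelings K v" "l' \<in> labelings K v" "d \<in> darts K" "e \<in> darts K"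
    and "\<And>x. x \<in> darts K \<Longrightarrow> x \<notin> circle K v d \<Longrightarrow> x \<notin> circle K v e \<Longrightarrow> l x = l' x"
    and "l d = l' d" "l e = l' e"
  shows "l = l'"
proof
  fix x show "l x = l' x"
    using assms labelings_circle[of _ K v] labelings_outside[of _ K v] by metis
qed

lemma finite_labelings:
  assumes "finite (crossings K)"
  shows "finite (labelings K v)"
proof (rule finite_subset)
  have "finite (darts K)" using assms by (simp add: darts_def)
  then show "finite {l :: 'a dart \<Rightarrow> label. \<forall>d. (d \<in> darts K \<longrightarrow> l d \<in> UNIV) \<and> (d \<notin> darts K \<longrightarrow> l d = X_plus)}"
    by (intro finite_set_of_finite_funs) (auto simp: UNIV_label)
qed (auto simp: labelings_def)

lemma states_iff: "(v, l) \<in> states K \<longleftrightarrow> v \<subseteq> crossings K \<and> l \<in> labelings K v"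
  by (auto simp: states_def)

lemma finite_states: "finite (crossings K) \<Longrightarrow> finite (states K)"
  by (simp add: states_def finite_labelings)

lemma sum_states:
  assumes "finite (crossings K)" "v \<subseteq> crossings K"
    and "\<And>w l. (w, l) \<in> states K \<Longrightarrow> w \<noteq> v \<Longrightarrow> F (w, l) = 0"
  shows "sum F (states K) = (\<Sum>l\<in>labelings K v. F (v, l))"
proof (rule sum_support)
  show "F y = 0" if "y \<in> states K" "y \<notin> Pair v ` labelings K v" for y
    using that assms(3)[of "fst y" "snd y"] by (cases y) (auto simp: states_iff)
qed (use assms(1,2) in \<open>auto simp: finite_states inj_on_def states_iff\<close>)

text \<open>These conditions make \<open>joined\<close> and \<open>smoothing\<close> involutions on
  the darts (for \<open>smoothing\<close> by the alternation of \<open>over\<close>), and they are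
  inherited under crossing changes, renaming and the Reidemeister move.\<close>

definition regular :: "'c diagram \<Rightarrow> bool" where
  "regular K \<longleftrightarrow> finite (crossings K) \<and>
     (\<forall>d\<in>darts K. joined K d \<in> darts K \<and> joined K (joined K d) = d) \<and>
     (\<forall>d\<in>darts K. over K (turn d) \<longleftrightarrow> \<not> over K d)"

lemma link_diagram_regular: "link_diagram K \<Longrightarrow> regular K"
  by (auto simp: link_diagram_def regular_def permutes_in_image)

lemma regularD:
  assumes "regular K"
  shows "finite (crossings K)" "d \<in> darts K \<Longrightarrow> joined K d \<in> darts K"
    "d \<in> darts K \<Longrightarrow> joined K (joined K d) = d"
    "x \<in> crossings K \<Longrightarrow> over K (x, i + 1) \<longleftrightarrow> \<not> over K (x, i)"
proof -
  assume "x \<in> crossings K"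
  then have "(x, i) \<in> darts K" by (simp add: darts_def)
  then have "over K (turn (x, i)) \<longleftrightarrow> \<not> over K (x, i)"
    using assms unfolding regular_def by blast
  then show "over K (x, i + 1) \<longleftrightarrow> \<not> over K (x, i)" by simp
qed (use assms in \<open>auto simp: regular_def\<close>)

lemma regular_over:
  assumes "regular K" "x \<in> crossings K"
  shows "over K (x, i + 2) \<longleftrightarrow> over K (x, i)" "over K (x, i + 3) \<longleftrightarrow> \<not> over K (x, i)"
  using regularD(4)[OF assms, of i] regularD(4)[OF assms, of "i + 1"]
    regularD(4)[OF assms, of "i + 2"] by simp_all

lemma smoothing_darts [simp]: "smoothing K v d \<in> darts K \<longleftrightarrow> d \<in> darts K"
  by (cases d) (auto simp: smoothing_def darts_def)

lemma smoothing_simps: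
  "over G (x, i) \<Longrightarrow> smoothing G v (x, i) = (x, if x \<in> v then i + 1 else i + 3)"
  "\<not> over G (x, i) \<Longrightarrow> smoothing G v (x, i) = (x, if x \<in> v then i + 3 else i + 1)"
  by (simp_all add: smoothing_def minus_one_four)

lemma smoothing_involution:
  assumes "regular K" "d \<in> darts K"
  shows "smoothing K v (smoothing K v d) = d"
proof (cases d)
  case (Pair x i)
  then have "x \<in> crossings K" using assms by (simp add: darts_def)
  from regularD(4)[OF assms(1) this, of i] regular_over[OF assms(1) this, of i]
  show ?thesis by (auto simp: Pair smoothing_def minus_one_four)
qed

text \<open>Both generators are involutions, so membership propagates backwards although
  \<open>reach\<close> is defined by directed steps.\<close>

lemma circle_iff:
  assumes "regular K" "x \<in> darts K"
  shows "joined K x \<in> circle K v d \<longleftrightarrow> x \<in> circle K v d"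
    "smoothing K v x \<in> circle K v d \<longleftrightarrow> x \<in> circle K v d"
  using circle_step[of x K v d] circle_step[of "joined K x" K v d]
    circle_step[of "smoothing K v x" K v d] assms regularD(2,3)[OF assms]
    smoothing_involution[OF assms] by (metis smoothing_darts)+

lemma circle_darts:
  assumes "regular K" "d \<in> darts K"
  shows "circle K v d \<subseteq> darts K"
  using assms regularD(2)[OF assms(1)] by (intro circle_subset) auto

section \<open>Relabeling a circle, and the basepoint maps\<close>

definition relabel :: "('d \<Rightarrow> label) \<Rightarrow> 'd set \<Rightarrow> label \<Rightarrow> 'd \<Rightarrow> label" where
  "relabel l C b = (\<lambda>x. if x \<in> C then b else l x)"

lemma relabel_labelings:
  assumes "regular K" "l \<in> labelings K v" "d \<in> darts K"
  shows "relabel l (circle K v d) b \<in> labelings K v"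
  using assms(2) circle_iff[OF assms(1)] circle_darts[OF assms(1,3), of v]
  unfolding labelings_iff by (auto simp: relabel_def darts_def subset_iff)

lemma relabel_same:
  assumes "l \<in> labelings K v" "d \<in> darts K" "l d = b"
  shows "relabel l (circle K v d) b = l"
  using labelings_circle[OF assms(1,2)] assms(3) by (auto simp: relabel_def)

text \<open>By \<open>x_- x_+ = x_-\<close> and \<open>x_- x_- = h x_-\<close>, the product always
  carries \<open>x_-\<close> on the circle through \<open>p\<close>, and a target with this label
  receives a contribution from either label of that circle.\<close>

lemma x_map_eq:
  assumes K: "regular K" and p: "p \<in> darts K"
  shows "x_map K p a (v, l) =
    (if (v, l) \<in> states K \<and> l p = X_minus
     then hvar * a (v, l) + a (v, relabel l (circle K v p) X_plus) else 0)"
proof (cases "(v, l) \<in> states K")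
  case True
  then have v: "v \<subseteq> crossings K" and l: "l \<in> labelings K v" by (auto simp: states_iff)
  let ?C = "circle K v p"
  have "x_map K p a (v, l) = (\<Sum>l'\<in>labelings K v. a (v, l') *
     (of_bool (\<forall>x\<in>darts K - ?C. l x = l' x) * mult_coeff (l' p) X_minus (l p)))"
    unfolding x_map_def basepoint_mult_def linear_map_def using True
    by (simp, subst sum_states[OF regularD(1)[OF K] v]) (auto split: prod.splits)
  \<comment> \<open>Only labelings that agree with \<open>l\<close> off the circle through
    \<open>p\<close> contribute, and these are its relabelings.\<close>
  also have "\<dots> = (\<Sum>b\<in>UNIV. a (v, relabel l ?C b) * mult_coeff b X_minus (l p))"
  proof (subst sum_support[where g = "relabel l ?C" and I = UNIV])
    show "inj (relabel l ?C)"
      by (rule inj_on_inverseI[where g = "\<lambda>l. l p"]) (simp add: relabel_def circle_self)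
    show "range (relabel l ?C) \<subseteq> labelings K v"
      using relabel_labelings[OF K l p] by auto
    show "a (v, y) * (of_bool (\<forall>x\<in>darts K - ?C. l x = y x) * mult_coeff (y p) X_minus (l p)) = 0"
      if y: "y \<in> labelings K v" "y \<notin> range (relabel l ?C)" for y
    proof -
      have "y = relabel l ?C (y p)" if *: "\<forall>x\<in>darts K - ?C. l x = y x"
        using * y relabel_labelings[OF K l p, of "y p"] p
        by (intro labeling_eqI[of _ K v _ p p]) (auto simp: relabel_def circle_self)
      with y(2) show ?thesis by auto
    qed
  qed (auto simp: finite_labelings regularD(1)[OF K] relabel_def circle_self intro!: sum.cong)
  also have "\<dots> = (if l p = X_minus then hvar * a (v, l) + a (v, relabel l ?C X_plus) else 0)"
    using relabel_same[OF l p] by (cases "l p") (simp_all add: sum_label)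
  finally show ?thesis using True by simp
qed (simp add: x_map_def basepoint_mult_def linear_map_def)

lemma x_map_cong:
  assumes "regular K" "p \<in> darts K" "\<And>l. l \<in> labelings K v \<Longrightarrow> a (v, l) = b (v, l)"
  shows "x_map K p a (v, l) = x_map K p b (v, l)"
  using assms by (auto simp: x_map_eq states_iff relabel_labelings)


section \<open>Crossing changes and renaming\<close>

lemma crossing_change_simps [simp]:
  "crossings (crossing_change c K) = crossings K" "joined (crossing_change c K) = joined K"
  "darts (crossing_change c K) = darts K"
  by (simp_all add: crossing_change_def darts_def)

lemma crossing_change_involution: "crossing_change c (crossing_change c K) = K"
  by (cases K) (auto simp: crossing_change_def)

text \<open>\<open>smoothing\<close> only compares \<open>over\<close> with membership in the
  vertex, so flipping both at \<open>c\<close> has no effect.\<close>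

lemma smoothing_crossing_change:
  assumes "c \<notin> v"
  shows "smoothing (crossing_change c K) v = smoothing K (insert c v)"
    "smoothing (crossing_change c K) (insert c v) = smoothing K v"
  using assms by (auto simp: smoothing_def crossing_change_def)

lemma circle_crossing_change:
  assumes "c \<notin> v"
  shows "circle (crossing_change c K) v = circle K (insert c v)"
    "circle (crossing_change c K) (insert c v) = circle K v"
  unfolding circle_def using smoothing_crossing_change[OF assms] by simp_all

lemma labelings_crossing_change:
  assumes "c \<notin> v"
  shows "labelings (crossing_change c K) v = labelings K (insert c v)"
    "labelings (crossing_change c K) (insert c v) = labelings K v"
  unfolding labelings_def using circle_crossing_change[OF assms] by simp_all

lemma regular_crossing_change: "regular K \<Longrightarrow> regular (crossing_change c K)"
  by (auto simp: regular_def crossing_change_def darts_def)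

lemma crossing_change_map_outside:
  assumes K: "regular K" and p: "p \<in> darts K" "q \<in> darts K" and c: "c \<in> crossings K"
    and a: "a \<in> bar_natan K" and s: "(v, l) \<notin> states (crossing_change c K)"
  shows "crossing_change_map K c p q a (v, l) = 0"
proof (cases "c \<in> v")
  case True
  then obtain u where u: "v = insert c u" "c \<notin> u" by (metis mk_disjoint_insert)
  then have "(u, l) \<notin> states K" using s c by (simp add: states_iff labelings_crossing_change)
  then show ?thesis using a u by (simp add: crossing_change_map_def bar_natan_def)
next
  case False
  then have "(insert c v, l) \<notin> states K" using s c by (simp add: states_iff labelings_crossing_change)
  then show ?thesis using False by (simp add: crossing_change_map_def x_map_eq[OF K] p)
qed

section \<open>Renaming a crossing\<close>

lemma transpose_image_iff: "transpose c c' x \<in> transpose c c' ` v \<longleftrightarrow> x \<in> v"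
  by (simp add: inj_image_mem_iff)

lemma rename_dart_involution [simp]: "rename_dart c c' (rename_dart c c' d) = d"
  by (cases d) (simp add: rename_dart_def)

lemma rename_dart_comp [simp]: "l \<circ> rename_dart c c' \<circ> rename_dart c c' = l"
  by (simp add: fun_eq_iff)

lemma rename_dart_Pair: "rename_dart c c' (x, i) = (transpose c c' x, i)"
  by (simp add: rename_dart_def)

lemma rename_diagram_simps [simp]:
  "crossings (rename_diagram c c' K) = transpose c c' ` crossings K"
  "joined (rename_diagram c c' K) d = rename_dart c c' (joined K (rename_dart c c' d))"
  "over (rename_diagram c c' K) d = over K (rename_dart c c' d)"
  by (simp_all add: rename_diagram_def)

lemma rename_dart_in_darts [simp]:
  "rename_dart c c' d \<in> darts (rename_diagram c c' K) \<longleftrightarrow> d \<in> darts K"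
  by (cases d) (simp add: darts_def rename_dart_Pair transpose_image_iff)

lemma in_darts_rename: "d \<in> darts (rename_diagram c c' K) \<longleftrightarrow> rename_dart c c' d \<in> darts K"
  by (metis rename_dart_involution rename_dart_in_darts)

lemma turn_rename_dart: "rename_dart c c' (turn d) = turn (rename_dart c c' d)"
  by (cases d) (simp add: rename_dart_Pair)

lemma regular_rename: "regular K \<Longrightarrow> regular (rename_diagram c c' K)"
  unfolding regular_def
  by (simp add: in_darts_rename turn_rename_dart)

lemma smoothing_rename:
  "smoothing (rename_diagram c c' K) (transpose c c' ` v) (rename_dart c c' d) =
   rename_dart c c' (smoothing K v d)"
  by (cases d) (simp add: smoothing_def rename_dart_Pair transpose_image_iff)

lemma rename_diagram_involution: "rename_diagram c c' (rename_diagram c c' K) = K"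
  by (cases K) (simp add: rename_diagram_def image_image fun_eq_iff)

lemma circle_rename_subset:
  "circle (rename_diagram c c' K) (transpose c c' ` v) (rename_dart c c' d)
    \<subseteq> rename_dart c c' ` circle K v d"
proof (rule circle_subset)
  fix x assume x: "x \<in> rename_dart c c' ` circle K v d" "x \<in> darts (rename_diagram c c' K)"
  then obtain y where y: "x = rename_dart c c' y" "y \<in> circle K v d" "y \<in> darts K" by auto
  then show "joined (rename_diagram c c' K) x \<in> rename_dart c c' ` circle K v d \<and>
    smoothing (rename_diagram c c' K) (transpose c c' ` v) x \<in> rename_dart c c' ` circle K v d"
    using circle_step[of y K v d] by (auto simp: smoothing_rename)
qed (simp add: circle_self)

lemma circle_rename:
  "circle (rename_diagram c c' K) (transpose c c' ` v) (rename_dart c c' d)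
    = rename_dart c c' ` circle K v d" (is "?A = ?B")
proof
  have "circle K v d \<subseteq> rename_dart c c' ` ?A"
    using circle_rename_subset[of c c' "rename_diagram c c' K" "transpose c c' ` v" "rename_dart c c' d"]
    by (simp add: rename_diagram_involution image_image)
  then show "?B \<subseteq> ?A" by force
qed (rule circle_rename_subset)

lemma labelings_rename:
  "l \<circ> rename_dart c c' \<in> labelings (rename_diagram c c' K) (transpose c c' ` v) \<longleftrightarrow>
   l \<in> labelings K v"
proof -
  \<comment> \<open>Stated for all diagrams and vertices because the converse is the instance at the
    renamed diagram, renaming being an involution.\<close>
  have 1: "l \<circ> rename_dart c c' \<in> labelings (rename_diagram c c' K) (transpose c c' ` v)"
    if "l \<in> labelings K v" for l v and K :: "'a diagram"
  proof -
    have "smoothing (rename_diagram c c' K) (transpose c c' ` v) d =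
      rename_dart c c' (smoothing K v (rename_dart c c' d))" for d
      using smoothing_rename[of c c' K v "rename_dart c c' d"] by simp
    with that show ?thesis
      unfolding labelings_iff
      by (simp add: in_darts_rename image_iff rename_dart_Pair)
  qed
  show ?thesis
    using 1[of l K v] 1[of "l \<circ> rename_dart c c'" "rename_diagram c c' K" "transpose c c' ` v"]
    by (auto simp: rename_diagram_involution image_image)
qed

lemma states_rename:
  "(transpose c c' ` v, l \<circ> rename_dart c c') \<in> states (rename_diagram c c' K) \<longleftrightarrow> (v, l) \<in> states K"
  by (simp add: states_iff labelings_rename inj_image_subset_iff)

lemma x_map_rename:
  assumes "regular K" "d \<in> darts K"
  shows "x_map (rename_diagram c c' K) (rename_dart c c' d) a
      (transpose c c' ` v, l \<circ> rename_dart c c') = x_map K d (rename_chain c c' a) (v, l)"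
proof -
  have "relabel (l \<circ> rename_dart c c') (rename_dart c c' ` circle K v d) b =
      relabel l (circle K v d) b \<circ> rename_dart c c'" for b
    by (auto simp: relabel_def fun_eq_iff) (metis imageI rename_dart_involution)
  then show ?thesis
    using assms
    by (simp add: x_map_eq regular_rename states_rename circle_rename rename_chain_def)
qed

text \<open>The two resolutions at \<open>c\<close> are exchanged while darts and circles remain, so
  a basepoint acts alike on both diagrams once chains are moved to the shifted vertex. The functions
  on the right perform this shift.\<close>

lemma x_map_crossing_change:
  assumes "regular K" "d \<in> darts K" "c \<in> crossings K" "c \<notin> v"
  shows "x_map (crossing_change c K) d a (v, l) =
      x_map K d (\<lambda>(w, l). a (w - {c}, l)) (insert c v, l)"
    and "x_map (crossing_change c K) d a (insert c v, l) =
      x_map K d (\<lambda>(w, l). a (insert c w, l)) (v, l)"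
  using assms
  by (simp_all add: x_map_eq regular_crossing_change states_iff labelings_crossing_change
      circle_crossing_change)

text \<open>The basepoint slides along a smoothing arc without leaving its circle.\<close>

lemma x_map_smoothing:
  assumes "regular K" "d \<in> darts K"
  shows "x_map K (smoothing K v d) a (v, l) = x_map K d a (v, l)"
proof (cases "(v, l) \<in> states K")
  case True
  have *: "smoothing K v (smoothing K v d) = d"
    using smoothing_involution[OF assms] .
  have "circle K v (smoothing K v d) = circle K v d"
    using circle_step[of _ K v] circle_subset[of _ "circle K v _" K v] assms(2) * circle_self[of _ K v]
    by (intro equalityI circle_subset) (metis smoothing_darts)+
  with True assms show ?thesis
    using circle_step(2)[OF circle_self assms(2), of v] labelings_circle[of l K v d]
    by (simp add: x_map_eq states_iff)
qed (simp add: x_map_eq assms)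

section \<open>Sums over the labelings of a resolution\<close>

lemma saddle_coeff_merge:
  "e \<notin> C d \<Longrightarrow> \<forall>x\<in>X - C d - C e. m x = l x \<Longrightarrow>
   saddle_coeff X C d e d' e' l m = mult_coeff (l d) (l e) (m d')"
  by (simp add: saddle_coeff_def)

text \<open>The target fixes the source off the circle through \<open>d\<close>, and the last
  assumption leaves only the label \<open>l d\<close> on that circle.\<close>

lemma sum_saddle_split:
  assumes "finite (crossings K)" "l \<in> labelings K v" "d \<in> darts K" "e \<in> circle K v d"
    and "\<And>x. x \<in> darts K \<Longrightarrow> x \<notin> circle K v d \<Longrightarrow> m x = l x"
    and "\<And>b. b \<noteq> l d \<Longrightarrow> comult_coeff b (m d') (m e') = 0"
  shows "(\<Sum>l'\<in>labelings K v. a l' * saddle_coeff (darts K) (circle K v) d e d' e' l' m) =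
    a l * comult_coeff (l d) (m d') (m e')"
proof (subst sum_single[where x = l])
  fix y assume y: "y \<in> labelings K v" "y \<noteq> l"
  show "a y * saddle_coeff (darts K) (circle K v) d e d' e' y m = 0"
  proof (rule ccontr)
    assume "a y * saddle_coeff (darts K) (circle K v) d e d' e' y m \<noteq> 0"
    then have *: "\<forall>x\<in>darts K - circle K v d - circle K v e. m x = y x"
      "comult_coeff (y d) (m d') (m e') \<noteq> 0"
      using assms(4) by (auto simp: saddle_coeff_def split: if_splits)
    then have "y d = l d" using assms(6) by blast
    have "circle K v e \<subseteq> circle K v d"
      using assms(4) by (intro circle_subset) (auto intro: circle_step)
    then have "y x = l x" if "x \<in> darts K" "x \<notin> circle K v d" for x
      using *(1) assms(5)[OF that] that by force
    with \<open>y d = l d\<close> have "y = l"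
      by (intro labeling_eqI[OF y(1) assms(2,3,3)])
    with y(2) show False ..
  qed
qed (use assms finite_labelings in \<open>auto simp: saddle_coeff_def\<close>)

text \<open>A product may have several pairs of factors. The last assumption selects one pair, and
  its condition \<open>a l' \<noteq> 0\<close> lets the support of the chain help in this.\<close>

lemma sum_saddle_merge:
  assumes "finite (crossings K)" "l \<in> labelings K v" "d \<in> darts K" "e \<in> darts K"
    and "e \<notin> circle K v d"
    and "\<And>x. x \<in> darts K \<Longrightarrow> x \<notin> circle K v d \<Longrightarrow> x \<notin> circle K v e \<Longrightarrow> m x = l x"
    and "\<And>l'. l' \<in> labelings K v \<Longrightarrow> a l' \<noteq> 0 \<Longrightarrow> mult_coeff (l' d) (l' e) (m d') \<noteq> 0 \<Longrightarrow>
      l' d = l d \<and> l' e = l e"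
  shows "(\<Sum>l'\<in>labelings K v. a l' * saddle_coeff (darts K) (circle K v) d e d' e' l' m) =
    a l * mult_coeff (l d) (l e) (m d')"
proof (subst sum_single[where x = l])
  fix y assume y: "y \<in> labelings K v" "y \<noteq> l"
  show "a y * saddle_coeff (darts K) (circle K v) d e d' e' y m = 0"
  proof (rule ccontr)
    assume "a y * saddle_coeff (darts K) (circle K v) d e d' e' y m \<noteq> 0"
    then have *: "\<forall>x\<in>darts K - circle K v d - circle K v e. m x = y x"
      "a y \<noteq> 0" "mult_coeff (y d) (y e) (m d') \<noteq> 0"
      using assms(5) by (auto simp: saddle_coeff_def split: if_splits)
    then have "y d = l d \<and> y e = l e" using assms(7) y(1) by blast
    then have "y = l"
      using *(1) assms(6) by (intro labeling_eqI[OF y(1) assms(2,3,4)]) auto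
    with y(2) show False ..
  qed
qed (use assms finite_labelings in \<open>auto simp: saddle_coeff_def\<close>)

lemma saddle_map_eq:
  assumes "finite (crossings K)" "(v, m) \<in> states (saddle d e K)"
  shows "saddle_map K d e a (v, m) = (\<Sum>l\<in>labelings K v. a (v, l) *
    saddle_coeff (darts K) (circle K v) d (joined K e) d (joined K e) l m)"
proof -
  have "v \<subseteq> crossings K" using assms(2) by (simp add: states_iff saddle_def)
  then show ?thesis
    unfolding saddle_map_def linear_map_def using assms
    by (simp, subst sum_states) (auto split: prod.splits)
qed

lemma saddle_map_eq_0: "(\<And>l. a (v, l) = 0) \<Longrightarrow> saddle_map K d e a (v, m) = 0"
  unfolding saddle_map_def linear_map_def by (auto intro!: sum.neutral)


section \<open>The diagrams after the Reidemeister move and after the saddle\<close>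

text \<open>In the rotated picture with \<open>j = k\<close>, true \<open>s\<close> stands for the
  two vertical arcs and false \<open>s\<close> for the two horizontal ones.\<close>

definition smooth_at :: "('c dart \<Rightarrow> label) \<Rightarrow> 'c \<Rightarrow> 4 \<Rightarrow> bool \<Rightarrow> bool" where
  "smooth_at l x j s \<longleftrightarrow> (if s then l (x, j) = l (x, j + 1) \<and> l (x, j + 2) = l (x, j + 3)
     else l (x, j) = l (x, j + 3) \<and> l (x, j + 1) = l (x, j + 2))"

lemma smooth_at_iff:
  assumes "over K (x, j) = s" "over K (x, j + 1) = (\<not> s)" "over K (x, j + 2) = s"
    "over K (x, j + 3) = (\<not> s)"
  shows "(\<forall>i. l (smoothing K v (x, i)) = l (x, i)) \<longleftrightarrow> smooth_at l x j (s \<longleftrightarrow> x \<in> v)"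
  unfolding all_four[of _ j] smooth_at_def smoothing_def
  using assms by (auto simp: minus_one_four)

lemma smoothing_cong:
  "over K (x, i) = over K' (x, i) \<Longrightarrow> (x \<in> v \<longleftrightarrow> x \<in> v') \<Longrightarrow>
   smoothing K v (x, i) = smoothing K' v' (x, i)"
  by (simp add: smoothing_def)

locale crossing_move =
  fixes K :: "'c diagram" and c c2 c3 :: 'c and k :: 4
  assumes link: "link_diagram K"
    and c: "c \<in> crossings K" "over K (c, k)" "inward K (c, k)" "inward K (c, k + 1)"
    and new: "c2 \<notin> crossings K" "c3 \<notin> crossings K" "c2 \<noteq> c3"
begin

text \<open>Here \<open>R\<close> is the diagram after the Reidemeister move, \<open>K'\<close> is
  \<open>K_-\<close> with its crossing called \<open>c3\<close>, and \<open>M\<close> is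
  \<open>K_-#H\<close> with Hopf crossings \<open>c\<close> and \<open>c2\<close>.\<close>

abbreviation "R \<equiv> r2_diagram K c k c2 c3"
abbreviation "K' \<equiv> rename_diagram c c3 (crossing_change c K)"
abbreviation "M \<equiv> hopf_sum K' (c3, k) c c2"
abbreviation "t \<equiv> rename_dart c c3"

lemma ne [simp]: "c \<noteq> c2" "c \<noteq> c3" "c2 \<noteq> c" "c3 \<noteq> c" "c3 \<noteq> c2" "c2 \<noteq> c3"
  using c new by auto

lemma regular_K: "regular K"
  using link by (rule link_diagram_regular)

lemma finite_K: "finite (crossings K)"
  using regular_K by (rule regularD)

lemma over_c: "over K (c, k)" "\<not> over K (c, k + 1)" "over K (c, k + 2)" "\<not> over K (c, k + 3)"
  using c regularD(4)[OF regular_K c(1)] regular_over[OF regular_K c(1)] by auto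

lemma dart_c [simp]: "(c, i) \<in> darts K" "(c2, i) \<notin> darts K" "(c3, i) \<notin> darts K"
  using c new by (auto simp: darts_def)

lemma saddle_R: "saddle (c, k + 3) (c2, k + 2) R = M"
  using saddle_r2_diagram_eq_hopf_sum[OF link c new] .

lemma t_Pair: "t (x, i) = (if x = c then (c3, i) else if x = c3 then (c, i) else (x, i))"
  by (auto simp: rename_dart_def transpose_def)

text \<open>The edges of the diagrams \<open>R\<close> and \<open>M\<close> are the images of the edges of \<open>K\<close> under \<open>up\<close> and \<open>low\<close>,
  respectively, and the four edges between the crossings \<open>c\<close>, \<open>c2\<close> and \<open>c3\<close> listed in
  \<open>joined_R_new\<close> and \<open>joined_M_new\<close>.\<close>

definition up :: "'c dart \<Rightarrow> 'c dart" where
  "up d = (if d = (c, k + 1) then (c3, k + 1) else if d = (c, k + 2) then (c3, k + 2) else d)"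

definition low :: "'c dart \<Rightarrow> 'c dart" where
  "low d = (if fst d = c \<and> d \<noteq> (c, k) then (c3, snd d) else d)"

lemma joined_darts: "d \<in> darts K \<Longrightarrow> joined K d \<in> darts K"
  using regularD(2)[OF regular_K] .

lemma joined_joined: "joined K (joined K d) = d"
  using link regularD(3)[OF regular_K, of d] permutes_not_in[of "joined K" "darts K" d]
  by (cases "d \<in> darts K") (simp_all add: link_diagram_def)

lemma joined_neq: "d \<in> darts K \<Longrightarrow> joined K d \<noteq> (c2, i)" "d \<in> darts K \<Longrightarrow> joined K d \<noteq> (c3, i)"
  using joined_darts dart_c by metis+

lemma joined_neq_inward: "d \<in> darts K \<Longrightarrow> inward K e = inward K d \<Longrightarrow> joined K d \<noteq> e"
  using link by (auto simp: link_diagram_def)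

text \<open>An edge joins an inward to an outward dart, while \<open>(c, k + 2)\<close> and
  \<open>(c, k + 3)\<close> both point outward. This excludes loops at which the saddle or the Hopf
  strand would degenerate.\<close>

lemma joined_c:
  "joined K (c, k) \<noteq> (c, k)" "joined K (c, k + 3) \<noteq> (c, k + 2)" "joined K (c, k + 3) \<noteq> (c, k + 3)"
proof -
  have "inward K (opposite d) \<longleftrightarrow> \<not> inward K d" if "d \<in> darts K" for d
    using link that by (simp add: link_diagram_def)
  from this[of "(c, k)"] this[of "(c, k + 1)"] c
  have "\<not> inward K (c, k + 2)" "\<not> inward K (c, k + 3)" by simp_all
  then show "joined K (c, k) \<noteq> (c, k)" "joined K (c, k + 3) \<noteq> (c, k + 2)"
    "joined K (c, k + 3) \<noteq> (c, k + 3)"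
    by (simp_all add: joined_neq_inward)
qed

lemma joined_R:
  assumes "d \<in> darts K"
  shows "joined R (up d) = up (joined K d)"
proof -
  \<comment> \<open>On the darts of \<open>K\<close>, none of which is at \<open>c3\<close>, the
    involution inside \<open>r2_diagram\<close> agrees with \<open>up\<close>, and it also undoes
    \<open>up\<close>.\<close>
  define up' where "up' = transpose (c, k + 1) (c3, k + 1) \<circ> transpose (c, k + 2) (c3, k + 2)"
  have up': "up' e = up e" "up' (up e) = e" if "e \<in> darts K" for e
    using that by (auto simp: up_def up'_def transpose_def)
  have "up d \<notin> {(c, k + 1), (c, k + 2), (c3, k), (c3, k + 3)}" "\<And>i. up d \<noteq> (c2, i)"
    using assms by (auto simp: up_def)
  then have "joined R (up d) = up' (joined K (up' (up d)))"
    by (simp add: r2_diagram_def Let_def glue_def up'_def)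
  with assms show ?thesis by (simp add: up' joined_darts)
qed

lemma joined_R_new:
  "joined R (c, k + 2) = (c2, k + 3)" "joined R (c2, k + 3) = (c, k + 2)"
  "joined R (c, k + 1) = (c2, k)" "joined R (c2, k) = (c, k + 1)"
  "joined R (c2, k + 2) = (c3, k + 3)" "joined R (c3, k + 3) = (c2, k + 2)"
  "joined R (c2, k + 1) = (c3, k)" "joined R (c3, k) = (c2, k + 1)"
  by (simp_all add: r2_diagram_def Let_def glue_def)

lemma joined_M:
  assumes "d \<in> darts K"
  shows "joined M (low d) = low (joined K d)"
proof -
  have inj: "joined K a = joined K b \<longleftrightarrow> a = b" for a b by (metis joined_joined)
  \<comment> \<open>The Hopf sum is inserted before \<open>(c3, k)\<close>. So the edge entering
    there now enters the Hopf crossing \<open>c\<close> at \<open>(c, k)\<close>, while all other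
    darts are merely renamed.\<close>
  have low: "low e = (if e = (c, k) then (c, k) else t e)" if "e \<in> darts K" for e
    using that by (cases e) (auto simp: low_def t_Pair)
  let ?z = "joined K (c, k)"
  have z: "?z \<in> darts K" "?z \<noteq> (c, k)"
    using joined_darts[OF dart_c(1)] joined_c by auto
  have tz: "t (c3, k) = (c, k)" by (simp add: t_Pair)
  have t_eq: "t d = t e \<longleftrightarrow> d = e" for e by (metis rename_dart_involution)
  have n: "t e \<noteq> (c, i)" "t e \<noteq> (c2, i)" "t e = (c3, i) \<longleftrightarrow> e = (c, i)" if "e \<in> darts K" for e i
    using that by (cases e; auto simp: t_Pair)+
  show ?thesis
  proof (cases "d = (c, k)")
    case True
    then show ?thesis using z n[OF z(1)]
      by (cases ?z) (auto simp: low hopf_sum_def Let_def glue_def tz)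
  next
    case False
    then have "joined M (low d) = (if d = ?z then (c, k) else t (joined K d))"
      using z n[OF assms] n[OF z(1)] assms
      by (simp add: low hopf_sum_def Let_def glue_def tz t_eq)
    then show ?thesis using assms
      by (auto simp: low joined_darts joined_joined) (metis joined_joined)
  qed
qed

lemma joined_M_new:
  "joined M (c, k + 2) = (c2, k + 3)" "joined M (c2, k + 3) = (c, k + 2)"
  "joined M (c, k + 1) = (c2, k)" "joined M (c2, k) = (c, k + 1)"
  "joined M (c, k + 3) = (c2, k + 2)" "joined M (c2, k + 2) = (c, k + 3)"
  "joined M (c2, k + 1) = (c3, k)" "joined M (c3, k) = (c2, k + 1)"
proof -
  have "t (joined K (c, k)) \<noteq> (c, i)" "t (joined K (c, k)) \<noteq> (c2, i)" for i
    using joined_darts[of "(c, k)"] by (cases "joined K (c, k)"; auto simp: t_Pair)+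
  moreover have "t (joined K (c, k)) \<noteq> (c3, k)"
    using joined_c(1) by (cases "joined K (c, k)") (auto simp: t_Pair)
  ultimately have "t (joined K (c, k)) \<noteq> (c, i)" "(c, i) \<noteq> t (joined K (c, k))"
    "t (joined K (c, k)) \<noteq> (c2, i)" "(c2, i) \<noteq> t (joined K (c, k))"
    "t (joined K (c, k)) \<noteq> (c3, k)" "(c3, k) \<noteq> t (joined K (c, k))" for i
    by metis+
  then show
    "joined M (c, k + 2) = (c2, k + 3)" "joined M (c2, k + 3) = (c, k + 2)"
    "joined M (c, k + 1) = (c2, k)" "joined M (c2, k) = (c, k + 1)"
    "joined M (c, k + 3) = (c2, k + 2)" "joined M (c2, k + 2) = (c, k + 3)"
    "joined M (c2, k + 1) = (c3, k)" "joined M (c3, k) = (c2, k + 1)"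
    by (simp_all add: hopf_sum_def Let_def glue_def t_Pair)
qed

lemma crossings_R [simp]: "crossings R = crossings K \<union> {c2, c3}"
  by (simp add: r2_diagram_def Let_def)

lemma crossings_M [simp]: "crossings M = crossings K \<union> {c2, c3}"
  using c by (auto simp: saddle_R[symmetric] saddle_def)

lemma over_R:
  "over R (c, i) = over K (c, i)" "over R (c2, i) \<longleftrightarrow> i \<in> {k, k + 2}"
  "over R (c3, i) \<longleftrightarrow> i \<in> {k + 1, k + 3}"
  "x \<noteq> c2 \<Longrightarrow> x \<noteq> c3 \<Longrightarrow> over R (x, i) = over K (x, i)"
  by (auto simp: r2_diagram_def Let_def)

lemma over_M: "over M = over R"
  by (simp add: saddle_R[symmetric] saddle_def)

lemma darts_M: "darts M = darts R"
  by (simp add: darts_def)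

lemma in_darts_R: "(x, i) \<in> darts R \<longleftrightarrow> (x, i) \<in> darts K \<or> x = c2 \<or> x = c3"
  by (auto simp: darts_def)

text \<open>The first decomposition fits the edges of \<open>R\<close>, the second those of
  \<open>M\<close>, which has the same darts.\<close>

lemma darts_R:
  "darts R = up ` darts K \<union> {(c, k + 1), (c, k + 2), (c3, k), (c3, k + 3),
     (c2, k), (c2, k + 1), (c2, k + 2), (c2, k + 3)}" (is "_ = ?A")
  "darts R = low ` darts K \<union> {(c, k + 1), (c, k + 2), (c, k + 3), (c3, k),
     (c2, k), (c2, k + 1), (c2, k + 2), (c2, k + 3)}" (is "_ = ?B")
proof -
  have 1: "e \<in> up ` darts K" if "e \<in> darts K" "e \<noteq> (c, k + 1)" "e \<noteq> (c, k + 2)" for e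
    using that by (intro image_eqI[of _ _ e]) (auto simp: up_def)
  have 2: "(c3, k + 1) \<in> up ` darts K" "(c3, k + 2) \<in> up ` darts K"
    by (rule image_eqI[of _ _ "(c, k + 1)"], simp_all add: up_def)
  have 3: "e \<in> low ` darts K" if "e \<in> darts K" "fst e \<noteq> c \<or> e = (c, k)" for e
    using that by (intro image_eqI[of _ _ e]) (auto simp: low_def)
  have 4: "(c3, i) \<in> low ` darts K" if "i \<noteq> k" for i
    using that by (intro image_eqI[of _ _ "(c, i)"]) (auto simp: low_def)
  have sub: "up e \<in> darts R" "low e \<in> darts R" if "e \<in> darts K" for e
    using that by (cases e; simp add: in_darts_R up_def low_def)+
  show "darts R = ?A"
  proof (intro equalityI subsetI)
    fix d assume "d \<in> darts R"
    then show "d \<in> ?A"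
      using 1[of d] 2 four_cases[of "snd d" k] by (cases d) (auto simp: in_darts_R)
  qed (use sub in \<open>auto simp: in_darts_R\<close>)
  show "darts R = ?B"
  proof (intro equalityI subsetI)
    fix d assume "d \<in> darts R"
    then show "d \<in> ?B"
      using 3[of d] 4[of "snd d"] four_cases[of "snd d" k] by (cases d) (auto simp: in_darts_R)
  qed (use sub in \<open>auto simp: in_darts_R\<close>)
qed

section \<open>Local conditions for labelings of the three diagrams\<close>

lemma smoothings_K:
  "(\<forall>x\<in>crossings K. \<forall>i. l (smoothing K v (x, i)) = l (x, i)) \<longleftrightarrow>
   (\<forall>x\<in>crossings K - {c}. \<forall>i. l (smoothing K v (x, i)) = l (x, i)) \<and> smooth_at l c k (c \<in> v)"
  using smooth_at_iff[of K c k True l v] over_c c(1) by auto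

text \<open>At \<open>c3\<close> the overstrand has the positions \<open>k + 1\<close> and
  \<open>k + 3\<close>, which reverses the condition there. Only \<open>over\<close> matters, so
  \<open>G\<close> can be \<open>R\<close> or \<open>M\<close>; away from \<open>c\<close> the
  vertex \<open>w\<close> can be read as a vertex \<open>v\<close> of \<open>K\<close>.\<close>

lemma smoothings_R:
  assumes "\<forall>x\<in>crossings K - {c}. x \<in> w \<longleftrightarrow> x \<in> v" "over G = over R"
  shows "(\<forall>x\<in>crossings K \<union> {c2, c3}. \<forall>i. l (smoothing G w (x, i)) = l (x, i)) \<longleftrightarrow>
   (\<forall>x\<in>crossings K - {c}. \<forall>i. l (smoothing K v (x, i)) = l (x, i)) \<and>
   smooth_at l c k (c \<in> w) \<and> smooth_at l c2 k (c2 \<in> w) \<and> smooth_at l c3 k (c3 \<notin> w)"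
proof -
  have 1: "(\<forall>i. l (smoothing G w (c, i)) = l (c, i)) \<longleftrightarrow> smooth_at l c k (c \<in> w)"
    using smooth_at_iff[of G c k True l w] over_c by (simp add: over_R assms)
  have 2: "(\<forall>i. l (smoothing G w (c2, i)) = l (c2, i)) \<longleftrightarrow> smooth_at l c2 k (c2 \<in> w)"
    using smooth_at_iff[of G c2 k True l w] by (simp add: over_R assms)
  have 3: "(\<forall>i. l (smoothing G w (c3, i)) = l (c3, i)) \<longleftrightarrow> smooth_at l c3 k (c3 \<notin> w)"
    using smooth_at_iff[of G c3 k False l w] by (simp add: over_R assms)
  have 4: "smoothing G w (x, i) = smoothing K v (x, i)" if "x \<in> crossings K - {c}" for x i
  proof (rule smoothing_cong)
    have "x \<noteq> c2" "x \<noteq> c3" using that new by auto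
    then show "over G (x, i) = over K (x, i)" by (simp add: over_R assms(2))
  qed (use assms(1) that in blast)
  have "crossings K \<union> {c2, c3} = (crossings K - {c}) \<union> {c, c2, c3}" using c(1) by auto
  then show ?thesis using 1 2 3 4 by auto
qed

lemma labelings_K:
  "l \<in> labelings K v \<longleftrightarrow> (\<forall>d\<in>darts K. l (joined K d) = l d) \<and>
   (\<forall>x\<in>crossings K - {c}. \<forall>i. l (smoothing K v (x, i)) = l (x, i)) \<and> smooth_at l c k (c \<in> v) \<and>
   (\<forall>d. d \<notin> darts K \<longrightarrow> l d = X_plus)"
  unfolding labelings_iff smoothings_K by blast

lemma edges_R: "(\<forall>d\<in>darts R. l (joined R d) = l d) \<longleftrightarrow>
    (\<forall>d\<in>darts K. l (up (joined K d)) = l (up d)) \<and>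
    l (c, k + 2) = l (c2, k + 3) \<and> l (c, k + 1) = l (c2, k) \<and> l (c2, k + 2) = l (c3, k + 3) \<and>
    l (c2, k + 1) = l (c3, k)"
  unfolding darts_R(1) ball_Un
  by (auto simp: joined_R joined_R_new)

lemma labelings_R:
  assumes "\<forall>x\<in>crossings K - {c}. x \<in> w \<longleftrightarrow> x \<in> v"
  shows "l \<in> labelings R w \<longleftrightarrow> (\<forall>d\<in>darts K. l (up (joined K d)) = l (up d)) \<and>
    l (c, k + 2) = l (c2, k + 3) \<and> l (c, k + 1) = l (c2, k) \<and> l (c2, k + 2) = l (c3, k + 3) \<and>
    l (c2, k + 1) = l (c3, k) \<and>
    (\<forall>x\<in>crossings K - {c}. \<forall>i. l (smoothing K v (x, i)) = l (x, i)) \<and>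
    smooth_at l c k (c \<in> w) \<and> smooth_at l c2 k (c2 \<in> w) \<and> smooth_at l c3 k (c3 \<notin> w) \<and>
    (\<forall>d. d \<notin> darts R \<longrightarrow> l d = X_plus)"
  unfolding labelings_iff crossings_R edges_R smoothings_R[OF assms refl] by blast

lemma edges_M: "(\<forall>d\<in>darts R. l (joined M d) = l d) \<longleftrightarrow>
    (\<forall>d\<in>darts K. l (low (joined K d)) = l (low d)) \<and>
    l (c, k + 2) = l (c2, k + 3) \<and> l (c, k + 1) = l (c2, k) \<and> l (c, k + 3) = l (c2, k + 2) \<and>
    l (c2, k + 1) = l (c3, k)"
  unfolding darts_R(2) ball_Un
  by (auto simp: joined_M joined_M_new)

lemma labelings_M:
  assumes "\<forall>x\<in>crossings K - {c}. x \<in> w \<longleftrightarrow> x \<in> v"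
  shows "l \<in> labelings M w \<longleftrightarrow> (\<forall>d\<in>darts K. l (low (joined K d)) = l (low d)) \<and>
    l (c, k + 2) = l (c2, k + 3) \<and> l (c, k + 1) = l (c2, k) \<and> l (c, k + 3) = l (c2, k + 2) \<and>
    l (c2, k + 1) = l (c3, k) \<and>
    (\<forall>x\<in>crossings K - {c}. \<forall>i. l (smoothing K v (x, i)) = l (x, i)) \<and>
    smooth_at l c k (c \<in> w) \<and> smooth_at l c2 k (c2 \<in> w) \<and> smooth_at l c3 k (c3 \<notin> w) \<and>
    (\<forall>d. d \<notin> darts R \<longrightarrow> l d = X_plus)"
  unfolding labelings_iff crossings_M darts_M edges_M smoothings_R[OF assms over_M] by blast


section \<open>Labelings of the relevant resolutions\<close>

text \<open>Here \<open>l\<close> labels a resolution of \<open>K\<close> with horizontal or vertical arcs at \<open>c\<close>. The circle between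
  \<open>c\<close> and \<open>c2\<close> is labelled by \<open>a\<close>, and the one between \<open>c2\<close> and \<open>c3\<close> by \<open>b\<close>.\<close>

definition R_horizontal :: "('c dart \<Rightarrow> label) \<Rightarrow> label \<Rightarrow> label \<Rightarrow> 'c dart \<Rightarrow> label" where
  "R_horizontal l a b = (\<lambda>(x, i).
     if x = c then (if i \<in> {k + 1, k + 2} then a else l (c, i))
     else if x = c2 then (if i \<in> {k, k + 3} then a else b)
     else if x = c3 then (if i \<in> {k, k + 3} then b else l (c, i))
     else l (x, i))"

text \<open>After the saddle the lower arc of \<open>K\<close> detours through \<open>c2\<close>,
  where it carries the label \<open>l (c, k)\<close>.\<close>

definition M_horizontal :: "('c dart \<Rightarrow> label) \<Rightarrow> label \<Rightarrow> 'c dart \<Rightarrow> label" where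
  "M_horizontal l a = (\<lambda>(x, i).
     if x = c then (if i \<in> {k + 1, k + 2} then a else l (c, i))
     else if x = c2 then (if i \<in> {k, k + 3} then a else l (c, k))
     else if x = c3 then l (c, i)
     else l (x, i))"

definition R_vertical :: "('c dart \<Rightarrow> label) \<Rightarrow> 'c dart \<Rightarrow> label" where
  "R_vertical l = (\<lambda>(x, i). if x = c2 \<or> x = c3 then l (c, i) else l (x, i))"

text \<open>Here \<open>a\<close> labels the Hopf circle, which runs through the left-hand darts of
  \<open>c\<close> and \<open>c2\<close>. The left strand passes only through
  \<open>c3\<close>.\<close>

definition M_vertical :: "('c dart \<Rightarrow> label) \<Rightarrow> label \<Rightarrow> 'c dart \<Rightarrow> label" where
  "M_vertical l a = (\<lambda>(x, i).
     if x = c \<or> x = c2 then (if i \<in> {k + 2, k + 3} then a else l (c, i))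
     else if x = c3 then l (c, i)
     else l (x, i))"

lemma smoothings_cong:
  assumes "l \<in> labelings K v" "\<forall>x\<in>crossings K - {c}. \<forall>i. l' (x, i) = l (x, i)"
  shows "\<forall>x\<in>crossings K - {c}. \<forall>i. l' (smoothing K v (x, i)) = l' (x, i)"
  using assms(1)[unfolded labelings_K] assms(2) by (simp add: smoothing_def)

lemma labelings_horizontal:
  assumes "l \<in> labelings K u" "c \<notin> u"
  shows "l (c, k + 3) = l (c, k)" "l (c, k + 2) = l (c, k + 1)"
  using assms by (simp_all add: labelings_K smooth_at_def)

lemma labelings_vertical:
  assumes "l \<in> labelings K v" "c \<in> v"
  shows "l (c, k + 1) = l (c, k)" "l (c, k + 3) = l (c, k + 2)"
  using assms by (simp_all add: labelings_K smooth_at_def)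

lemma R_horizontal_up:
  assumes "l \<in> labelings K u" "c \<notin> u" "d \<in> darts K"
  shows "R_horizontal l a b (up d) = l d"
  using labelings_horizontal[OF assms(1,2)] assms(3)
  by (cases d) (auto simp: R_horizontal_def up_def)

lemma M_horizontal_low:
  assumes "d \<in> darts K"
  shows "M_horizontal l a (low d) = l d"
  using assms by (cases d) (auto simp: M_horizontal_def low_def)

lemma R_vertical_up:
  assumes "d \<in> darts K"
  shows "R_vertical l (up d) = l d"
  using assms by (cases d) (auto simp: R_vertical_def up_def)

lemma M_vertical_low:
  assumes "d \<in> darts K"
  shows "M_vertical l a (low d) = l d"
  using assms by (cases d) (auto simp: M_vertical_def low_def)

text \<open>Along \<open>up\<close> the new labeling restricts to \<open>l\<close>, which settles
  the old edges; the new edges and the three crossings are checked directly. The next three lemmas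
  follow the same scheme, with \<open>low\<close> for \<open>M\<close>.\<close>

lemma R_horizontal_labelings:
  assumes l: "l \<in> labelings K u" and u: "u \<subseteq> crossings K - {c}"
  shows "R_horizontal l a b \<in> labelings R (insert c3 u)" (is "?l \<in> _")
proof -
  have cu: "c \<notin> u" "c2 \<notin> u" using u new by auto
  have "\<forall>x\<in>crossings K - {c}. \<forall>i. R_horizontal l a b (x, i) = l (x, i)"
    using new by (auto simp: R_horizontal_def)
  note 1 = smoothings_cong[OF l this]
  have 2: "R_horizontal l a b d = X_plus" if "d \<notin> darts R" for d
    using that l[unfolded labelings_K] by (cases d) (auto simp: R_horizontal_def in_darts_R)
  have 3: "\<forall>x\<in>crossings K - {c}. x \<in> insert c3 u \<longleftrightarrow> x \<in> u"
    using new by auto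
  have 4: "smooth_at ?l c k False" "smooth_at ?l c2 k False" "smooth_at ?l c3 k False"
    "?l (c, k + 2) = ?l (c2, k + 3)" "?l (c, k + 1) = ?l (c2, k)" "?l (c2, k + 2) = ?l (c3, k + 3)"
    "?l (c2, k + 1) = ?l (c3, k)"
    using labelings_horizontal[OF l cu(1)] by (simp_all add: smooth_at_def R_horizontal_def)
  show ?thesis
    unfolding labelings_R[OF 3]
    using l cu 1 2 4 by (simp add: labelings_K R_horizontal_up[OF l cu(1)] joined_darts)
qed

lemma M_horizontal_labelings:
  assumes l: "l \<in> labelings K u" and u: "u \<subseteq> crossings K - {c}"
  shows "M_horizontal l a \<in> labelings M (insert c3 u)" (is "?l \<in> _")
proof -
  have cu: "c \<notin> u" "c2 \<notin> u" using u new by auto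
  have "\<forall>x\<in>crossings K - {c}. \<forall>i. M_horizontal l a (x, i) = l (x, i)"
    using new by (auto simp: M_horizontal_def)
  note 1 = smoothings_cong[OF l this]
  have 2: "M_horizontal l a d = X_plus" if "d \<notin> darts R" for d
    using that l[unfolded labelings_K] by (cases d) (auto simp: M_horizontal_def in_darts_R)
  have 3: "\<forall>x\<in>crossings K - {c}. x \<in> insert c3 u \<longleftrightarrow> x \<in> u"
    using new by auto
  have 4: "smooth_at ?l c k False" "smooth_at ?l c2 k False" "smooth_at ?l c3 k False"
    "?l (c, k + 2) = ?l (c2, k + 3)" "?l (c, k + 1) = ?l (c2, k)" "?l (c, k + 3) = ?l (c2, k + 2)"
    "?l (c2, k + 1) = ?l (c3, k)"
    using labelings_horizontal[OF l cu(1)] by (simp_all add: smooth_at_def M_horizontal_def)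
  show ?thesis
    unfolding labelings_M[OF 3]
    using l cu 1 2 4 by (simp add: labelings_K M_horizontal_low joined_darts)
qed

lemma R_vertical_labelings:
  assumes l: "l \<in> labelings K (insert c u)" and u: "u \<subseteq> crossings K - {c}"
  shows "R_vertical l \<in> labelings R (insert c2 (insert c u))" (is "?l \<in> _")
proof -
  have cu: "c \<notin> u" "c2 \<notin> u" "c3 \<notin> u" using u new by auto
  have "\<forall>x\<in>crossings K - {c}. \<forall>i. R_vertical l (x, i) = l (x, i)"
    using new by (auto simp: R_vertical_def)
  note 1 = smoothings_cong[OF l this]
  have 2: "R_vertical l d = X_plus" if "d \<notin> darts R" for d
    using that l[unfolded labelings_K] by (cases d) (auto simp: R_vertical_def in_darts_R)
  have 3: "\<forall>x\<in>crossings K - {c}. x \<in> insert c2 (insert c u) \<longleftrightarrow> x \<in> insert c u"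
    using new by auto
  have 4: "smooth_at ?l c k True" "smooth_at ?l c2 k True" "smooth_at ?l c3 k True"
    "?l (c, k + 2) = ?l (c2, k + 3)" "?l (c, k + 1) = ?l (c2, k)" "?l (c2, k + 2) = ?l (c3, k + 3)"
    "?l (c2, k + 1) = ?l (c3, k)"
    using labelings_vertical[OF l] by (simp_all add: smooth_at_def R_vertical_def)
  show ?thesis
    unfolding labelings_R[OF 3]
    using l cu 1 2 4 by (simp add: labelings_K R_vertical_up joined_darts)
qed

lemma M_vertical_labelings:
  assumes l: "l \<in> labelings K (insert c u)" and u: "u \<subseteq> crossings K - {c}"
  shows "M_vertical l a \<in> labelings M (insert c2 (insert c u))" (is "?l \<in> _")
proof -
  have cu: "c \<notin> u" "c2 \<notin> u" "c3 \<notin> u" using u new by auto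
  have "\<forall>x\<in>crossings K - {c}. \<forall>i. M_vertical l a (x, i) = l (x, i)"
    using new by (auto simp: M_vertical_def)
  note 1 = smoothings_cong[OF l this]
  have 2: "M_vertical l a d = X_plus" if "d \<notin> darts R" for d
    using that l[unfolded labelings_K] by (cases d) (auto simp: M_vertical_def in_darts_R)
  have 3: "\<forall>x\<in>crossings K - {c}. x \<in> insert c2 (insert c u) \<longleftrightarrow> x \<in> insert c u"
    using new by auto
  have 4: "smooth_at ?l c k True" "smooth_at ?l c2 k True" "smooth_at ?l c3 k True"
    "?l (c, k + 2) = ?l (c2, k + 3)" "?l (c, k + 1) = ?l (c2, k)" "?l (c, k + 3) = ?l (c2, k + 2)"
    "?l (c2, k + 1) = ?l (c3, k)"
    using labelings_vertical[OF l] by (simp_all add: smooth_at_def M_vertical_def)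
  show ?thesis
    unfolding labelings_M[OF 3]
    using l cu 1 2 4 by (simp add: labelings_K M_vertical_low joined_darts)
qed

text \<open>The dart \<open>(c, k)\<close> does not belong to \<open>K'\<close>, so the restriction
  does not see it. Its label is found at the other end of its edge.\<close>

lemma M_restrict:
  assumes m: "m \<in> labelings M w" and l: "l \<in> labelings K v" and r: "restrict_labeling K' m = l \<circ> t"
  shows "m (c3, i) = l (c, i)" "m (c, k) = l (c, k)" "x \<notin> {c, c2, c3} \<Longrightarrow> m (x, i) = l (x, i)"
proof -
  have eq: "m (t d) = l d" if "d \<in> darts K" for d
    using fun_cong[OF r, of "t d"] that by (simp add: restrict_labeling_def)
  show "m (c3, i) = l (c, i)" using eq[of "(c, i)"] by (simp add: t_Pair)
  have "m (joined M (low (c, k))) = m (low (c, k))"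
    using m by (simp add: labelings_iff darts_M in_darts_R low_def)
  moreover have "low (joined K (c, k)) = t (joined K (c, k))"
    using joined_c(1) joined_neq[of "(c, k)"]
    by (cases "joined K (c, k)") (auto simp: low_def t_Pair)
  ultimately show "m (c, k) = l (c, k)"
    using eq[of "joined K (c, k)"] l
    by (simp add: joined_M joined_darts labelings_K) (simp add: low_def)
  show "m (x, i) = l (x, i)" if "x \<notin> {c, c2, c3}"
  proof (cases "(x, i) \<in> darts K")
    case True
    with eq[of "(x, i)"] that show ?thesis by (simp add: t_Pair)
  next
    case False
    with that have "(x, i) \<notin> darts M" by (simp add: darts_M in_darts_R)
    with False show ?thesis using labelings_outside[OF m] labelings_outside[OF l] by simp
  qed
qed

text \<open>A labeling of the resolution \<open>L_00\<close> is a labeling for \<open>K'\<close>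
  together with the label of the Hopf circle. The next lemma does the same for
  \<open>L_11\<close>.\<close>

lemma M_horizontal_unique:
  assumes m: "m \<in> labelings M (insert c3 u)" and l: "l \<in> labelings K u"
    and u: "u \<subseteq> crossings K - {c}" and r: "restrict_labeling K' m = l \<circ> t"
  shows "m = M_horizontal l (m (c, k + 2))"
proof
  have cu: "c \<notin> u" "c2 \<notin> u" using u new by auto
  have 3: "\<forall>x\<in>crossings K - {c}. x \<in> insert c3 u \<longleftrightarrow> x \<in> u"
    using new by auto
  have m': "m (c, k + 2) = m (c2, k + 3)" "m (c, k + 1) = m (c2, k)"
    "m (c, k + 3) = m (c2, k + 2)" "m (c2, k + 1) = m (c3, k)" "m (c, k) = m (c, k + 3)"
    "m (c, k + 1) = m (c, k + 2)"
    using m[unfolded labelings_M[OF 3]] cu by (simp_all add: smooth_at_def)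
  fix d show "m d = M_horizontal l (m (c, k + 2)) d"
    using m' M_restrict[OF m l r] four_cases[of "snd d" k] labelings_horizontal(1)[OF l cu(1)]
    by (cases d) (auto simp: M_horizontal_def)
qed

lemma M_vertical_unique:
  assumes m: "m \<in> labelings M (insert c2 (insert c u))" and l: "l \<in> labelings K (insert c u)"
    and u: "u \<subseteq> crossings K - {c}" and r: "restrict_labeling K' m = l \<circ> t"
  shows "m = M_vertical l (m (c, k + 2))"
proof
  have 3: "\<forall>x\<in>crossings K - {c}. x \<in> insert c2 (insert c u) \<longleftrightarrow> x \<in> insert c u"
    using new by auto
  have m': "m (c, k + 2) = m (c2, k + 3)" "m (c, k + 1) = m (c2, k)"
    "m (c, k + 3) = m (c2, k + 2)" "m (c2, k + 1) = m (c3, k)" "m (c, k) = m (c, k + 1)"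
    "m (c, k + 3) = m (c, k + 2)"
    using m[unfolded labelings_M[OF 3]] by (simp_all add: smooth_at_def)
  fix d show "m d = M_vertical l (m (c, k + 2)) d"
    using m' M_restrict[OF m l r] four_cases[of "snd d" k] labelings_vertical(1)[OF l]
    by (cases d) (auto simp: M_vertical_def)
qed

text \<open>The \<open>(1,0)\<close>-resolution only prolongs the two strands of \<open>K\<close>
  through \<open>c2\<close> and \<open>c3\<close>. There is no extra circle, and the labels spread
  along the strands.\<close>

lemma R_vertical_unique:
  assumes m: "m \<in> labelings R (insert c2 (insert c u))" and l: "l \<in> labelings K (insert c u)"
    and u: "u \<subseteq> crossings K - {c}" and r: "restrict_labeling K m = l"
  shows "m = R_vertical l"
proof
  have eq: "m d = l d" if "d \<in> darts K" for d
    using fun_cong[OF r, of d] that by (simp add: restrict_labeling_def)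
  have "c3 \<notin> u" using u new by auto
  have 3: "\<forall>x\<in>crossings K - {c}. x \<in> insert c2 (insert c u) \<longleftrightarrow> x \<in> insert c u"
    using new by auto
  have m': "m (c, k + 2) = m (c2, k + 3)" "m (c, k + 1) = m (c2, k)"
    "m (c2, k + 2) = m (c3, k + 3)" "m (c2, k + 1) = m (c3, k)" "m (c2, k) = m (c2, k + 1)"
    "m (c2, k + 2) = m (c2, k + 3)" "m (c3, k) = m (c3, k + 1)" "m (c3, k + 2) = m (c3, k + 3)"
    using m[unfolded labelings_R[OF 3]] \<open>c3 \<notin> u\<close> by (auto simp: smooth_at_def)
  have "\<forall>i. m (c2, i) = l (c, i) \<and> m (c3, i) = l (c, i)"
    unfolding all_four[of _ k] using m' eq[OF dart_c(1)] labelings_vertical[OF l insertI1] by metis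
  note R = this[rule_format]
  fix d show "m d = R_vertical l d"
  proof (cases "d \<in> darts R")
    case True
    then show ?thesis
      using R[of "snd d"] eq[of d] by (cases d) (auto simp: R_vertical_def in_darts_R)
  next
    case False
    then show ?thesis using labelings_outside[OF m] labelings_outside[OF l]
      by (cases d) (auto simp: R_vertical_def in_darts_R)
  qed
qed


section \<open>The circles of the resolutions after the Reidemeister move\<close>

lemma finite_R: "finite (crossings R)"
  and finite_M: "finite (crossings M)"
  by (simp_all add: finite_K)

lemma up_darts: "d \<in> darts K \<Longrightarrow> up d \<in> darts R"
  by (simp add: darts_R(1))

lemma regular_R: "regular R"
  unfolding regular_def
proof (intro conjI ballI)
  fix d assume d: "d \<in> darts R"
  show "joined R d \<in> darts R" "joined R (joined R d) = d"
    using d[unfolded darts_R(1)]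
    by (auto simp: joined_R joined_R_new joined_darts joined_joined up_darts in_darts_R)
  show "over R (turn d) \<longleftrightarrow> \<not> over R d"
  proof (cases d)
    case (Pair x i)
    have "over K (x, i + 1) \<longleftrightarrow> \<not> over K (x, i)" if "x \<noteq> c2" "x \<noteq> c3"
      using d that regularD(4)[OF regular_K] by (auto simp: Pair darts_def)
    then show ?thesis
      using four_cases[of i k] by (cases "x = c2"; cases "x = c3") (auto simp: Pair over_R)
  qed
qed (rule finite_R)

lemma smoothing_up:
  assumes "(x, i) \<in> darts K" "x \<noteq> c" "\<forall>x\<in>crossings K - {c}. x \<in> w \<longleftrightarrow> x \<in> v" "over G = over R"
  shows "smoothing G w (x, i) = smoothing K v (x, i)" "up (x, i) = (x, i)"
    "up (smoothing K v (x, i)) = smoothing K v (x, i)"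
proof -
  have "x \<in> crossings K" "x \<noteq> c2" "x \<noteq> c3" using assms(1) new by (auto simp: darts_def)
  then show "smoothing G w (x, i) = smoothing K v (x, i)" "up (x, i) = (x, i)"
    "up (smoothing K v (x, i)) = smoothing K v (x, i)"
    using assms by (auto simp: smoothing_def over_R up_def)
qed

text \<open>The upper arc moves from \<open>c\<close> to \<open>c3\<close> and the lower one stays,
  so \<open>up\<close> commutes with the smoothings and carries steps along the circle to
  steps.\<close>

lemma circle_R_horizontal:
  assumes u: "u \<subseteq> crossings K - {c}" and x: "x \<in> circle K u (c, k + 2)" "x \<in> darts K"
  shows "up x \<in> circle R (insert c3 u) (c3, k + 2)"
proof -
  let ?C = "circle R (insert c3 u) (c3, k + 2)"
  have cu: "c \<notin> u" "c2 \<notin> u" using u new by auto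
  have 3: "\<forall>x\<in>crossings K - {c}. x \<in> insert c3 u \<longleftrightarrow> x \<in> u"
    using new by auto
  have "circle K u (c, k + 2) \<subseteq> {x. x \<in> darts K \<longrightarrow> up x \<in> ?C}"
  proof (rule circle_subset)
    fix y assume y: "y \<in> {x. x \<in> darts K \<longrightarrow> up x \<in> ?C}" "y \<in> darts K"
    then have C: "up y \<in> ?C" by simp
    have "up (joined K y) \<in> ?C"
      using circle_step(1)[OF C up_darts[OF y(2)]] y by (simp add: joined_R)
    moreover have "up (smoothing K u y) = smoothing R (insert c3 u) (up y)"
    proof (cases y)
      case (Pair z i)
      show ?thesis
        using y cu four_cases[of i k] over_c smoothing_up[OF _ _ 3 refl, of z i]
        by (cases "z = c") (auto simp: Pair up_def smoothing_simps over_R)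
    qed
    ultimately show "joined K y \<in> {x. x \<in> darts K \<longrightarrow> up x \<in> ?C} \<and>
      smoothing K u y \<in> {x. x \<in> darts K \<longrightarrow> up x \<in> ?C}"
      using circle_step(2)[OF C up_darts[OF y(2)]] by simp
  qed (simp add: up_def circle_self)
  with x show ?thesis by blast
qed

text \<open>The twist region consists of a right strand from \<open>(c, k)\<close> to
  \<open>(c3, k + 1)\<close> and a left strand from \<open>(c, k + 3)\<close> to
  \<open>(c3, k + 2)\<close>, each a chain of edges and arcs.\<close>

lemma circle_R_strands:
  fixes u d
  defines "C \<equiv> circle R (insert c2 (insert c u)) d"
  assumes u: "u \<subseteq> crossings K - {c}"
  shows "(c, k + 1) \<in> C \<longleftrightarrow> (c, k) \<in> C" "(c2, k) \<in> C \<longleftrightarrow> (c, k) \<in> C"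
    "(c2, k + 1) \<in> C \<longleftrightarrow> (c, k) \<in> C" "(c3, k) \<in> C \<longleftrightarrow> (c, k) \<in> C" "(c3, k + 1) \<in> C \<longleftrightarrow> (c, k) \<in> C"
    "(c, k + 2) \<in> C \<longleftrightarrow> (c, k + 3) \<in> C" "(c2, k + 3) \<in> C \<longleftrightarrow> (c, k + 3) \<in> C"
    "(c2, k + 2) \<in> C \<longleftrightarrow> (c, k + 3) \<in> C" "(c3, k + 3) \<in> C \<longleftrightarrow> (c, k + 3) \<in> C"
    "(c3, k + 2) \<in> C \<longleftrightarrow> (c, k + 3) \<in> C"
proof -
  have cu: "c \<notin> u" "c2 \<notin> u" "c3 \<notin> u" using u new by auto
  have iff: "joined R x \<in> C \<longleftrightarrow> x \<in> C" "smoothing R (insert c2 (insert c u)) x \<in> C \<longleftrightarrow> x \<in> C"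
    if "x \<in> darts R" for x
    using circle_iff[OF regular_R that] by (simp_all add: C_def)
  have 1: "(c, k + 1) \<in> C \<longleftrightarrow> (c, k) \<in> C" and 2: "(c, k + 2) \<in> C \<longleftrightarrow> (c, k + 3) \<in> C"
    and 3: "(c2, k + 1) \<in> C \<longleftrightarrow> (c2, k) \<in> C" and 4: "(c2, k + 2) \<in> C \<longleftrightarrow> (c2, k + 3) \<in> C"
    and 5: "(c3, k + 1) \<in> C \<longleftrightarrow> (c3, k) \<in> C" and 6: "(c3, k + 2) \<in> C \<longleftrightarrow> (c3, k + 3) \<in> C"
    using iff(2)[of "(c, k)"] iff(2)[of "(c, k + 3)"] iff(2)[of "(c2, k)"] iff(2)[of "(c2, k + 3)"]
      iff(2)[of "(c3, k)"] iff(2)[of "(c3, k + 3)"] cu over_c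
    by (simp_all add: smoothing_simps over_R in_darts_R)
  have 7: "(c2, k) \<in> C \<longleftrightarrow> (c, k + 1) \<in> C" and 8: "(c2, k + 3) \<in> C \<longleftrightarrow> (c, k + 2) \<in> C"
    and 9: "(c3, k) \<in> C \<longleftrightarrow> (c2, k + 1) \<in> C" and 10: "(c3, k + 3) \<in> C \<longleftrightarrow> (c2, k + 2) \<in> C"
    using iff(1)[of "(c, k + 1)"] iff(1)[of "(c, k + 2)"] iff(1)[of "(c2, k + 1)"]
      iff(1)[of "(c2, k + 2)"] by (simp_all add: joined_R_new in_darts_R)
  show "(c, k + 1) \<in> C \<longleftrightarrow> (c, k) \<in> C" "(c2, k) \<in> C \<longleftrightarrow> (c, k) \<in> C"
    "(c2, k + 1) \<in> C \<longleftrightarrow> (c, k) \<in> C" "(c3, k) \<in> C \<longleftrightarrow> (c, k) \<in> C" "(c3, k + 1) \<in> C \<longleftrightarrow> (c, k) \<in> C"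
    "(c, k + 2) \<in> C \<longleftrightarrow> (c, k + 3) \<in> C" "(c2, k + 3) \<in> C \<longleftrightarrow> (c, k + 3) \<in> C"
    "(c2, k + 2) \<in> C \<longleftrightarrow> (c, k + 3) \<in> C" "(c3, k + 3) \<in> C \<longleftrightarrow> (c, k + 3) \<in> C"
    "(c3, k + 2) \<in> C \<longleftrightarrow> (c, k + 3) \<in> C"
    using 1 2 3 4 5 6 7 8 9 10 by blast+
qed

lemma circle_R_vertical:
  assumes u: "u \<subseteq> crossings K - {c}" and x: "x \<in> circle K (insert c u) (c, k + 3)" "x \<in> darts K"
  shows "up x \<in> circle R (insert c2 (insert c u)) (c, k + 3)"
proof -
  let ?w = "insert c2 (insert c u)"
  let ?C = "circle R ?w (c, k + 3)"
  have cu: "c \<notin> u" "c2 \<notin> u" "c3 \<notin> u" using u new by auto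
  have 3: "\<forall>x\<in>crossings K - {c}. x \<in> ?w \<longleftrightarrow> x \<in> insert c u"
    using new by auto
  have "circle K (insert c u) (c, k + 3) \<subseteq> {x. x \<in> darts K \<longrightarrow> up x \<in> ?C}"
  proof (rule circle_subset)
    fix y assume y: "y \<in> {x. x \<in> darts K \<longrightarrow> up x \<in> ?C}" "y \<in> darts K"
    then have C: "up y \<in> ?C" by simp
    have "up (joined K y) \<in> ?C"
      using circle_step(1)[OF C up_darts[OF y(2)]] y by (simp add: joined_R)
    \<comment> \<open>Here an arc at \<open>c\<close> is stretched into a whole strand, so that
      \<open>circle_R_strands\<close> takes the place of commutation of \<open>up\<close> with the
      smoothing.\<close>
    moreover have "up (smoothing K (insert c u) y) \<in> ?C"
    proof (cases y)
      case (Pair z i)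
      show ?thesis
      proof (cases "z = c")
        case True
        then show ?thesis
          using C four_cases[of i k] over_c circle_R_strands[OF u, of "(c, k + 3)"]
          by (auto simp: Pair up_def smoothing_simps)
      next
        case False
        then show ?thesis
          using circle_step(2)[OF C up_darts[OF y(2)]] y(2)
            smoothing_up[OF _ False 3 refl, of i] by (simp add: Pair)
      qed
    qed
    ultimately show "joined K y \<in> {x. x \<in> darts K \<longrightarrow> up x \<in> ?C} \<and>
      smoothing K (insert c u) y \<in> {x. x \<in> darts K \<longrightarrow> up x \<in> ?C}" by simp
  qed (simp add: up_def circle_self)
  with x show ?thesis by blast
qed


section \<open>The map of the Reidemeister move\<close>

lemma states_R_horizontal:
  assumes "l \<in> labelings K u" "u \<subseteq> crossings K - {c}"
  shows "(insert c3 u, R_horizontal l a b) \<in> states R"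
  using R_horizontal_labelings[OF assms] assms(2) by (auto simp: states_iff)

lemma states_R_vertical:
  assumes "l \<in> labelings K (insert c u)" "u \<subseteq> crossings K - {c}"
  shows "(insert c2 (insert c u), R_vertical l) \<in> states R"
  using R_vertical_labelings[OF assms] assms(2) c(1) by (auto simp: states_iff)

lemma states_M_horizontal:
  assumes "l \<in> labelings K u" "u \<subseteq> crossings K - {c}"
  shows "(insert c3 u, M_horizontal l a) \<in> states M"
  using M_horizontal_labelings[OF assms] assms(2) by (auto simp: states_iff)

lemma states_M_vertical:
  assumes "l \<in> labelings K (insert c u)" "u \<subseteq> crossings K - {c}"
  shows "(insert c2 (insert c u), M_vertical l a) \<in> states M"
  using M_vertical_labelings[OF assms] assms(2) c(1) by (auto simp: states_iff)

lemma restrict_R_vertical: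
  assumes "l \<in> labelings K v"
  shows "restrict_labeling K (R_vertical l) = l"
proof
  fix d show "restrict_labeling K (R_vertical l) d = l d"
    using labelings_outside[OF assms, of d]
    by (cases d) (auto simp: restrict_labeling_def R_vertical_def)
qed

lemma restrict_M:
  assumes "l \<in> labelings K v"
  shows "restrict_labeling K' (M_vertical l a) = l \<circ> t" "restrict_labeling K' (M_horizontal l a) = l \<circ> t"
proof -
  have *: "restrict_labeling K' m (t d) = l d"
    if "\<And>d. d \<in> darts K \<Longrightarrow> m (t d) = l d" for m d
    using labelings_outside[OF assms, of d] that[of d] by (auto simp: restrict_labeling_def)
  have "restrict_labeling K' (M_vertical l a) (t d) = l d"
    "restrict_labeling K' (M_horizontal l a) (t d) = l d" for d
    by (rule *, cases d; auto simp: M_vertical_def M_horizontal_def t_Pair; fail)+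
  then show "restrict_labeling K' (M_vertical l a) = l \<circ> t"
    "restrict_labeling K' (M_horizontal l a) = l \<circ> t"
    unfolding fun_eq_iff comp_def by (metis rename_dart_involution)+
qed

text \<open>This is \<open>(\<epsilon> \<otimes> id) \<Delta> = id\<close>: with \<open>x_-\<close>
  on the circle cut off above \<open>c\<close>, the comultiplication has coefficient 1 exactly when
  the other factor keeps the source label.\<close>

lemma r2_map_horizontal:
  assumes l: "l \<in> labelings K u" and u: "u \<subseteq> crossings K - {c}"
  shows "r2_map K c k c2 c3 a (insert c3 u, R_horizontal l X_minus X_plus) = a (u, l)"
proof -
  let ?m = "R_horizontal l X_minus X_plus"
  have cu: "c \<notin> u" "c2 \<notin> u" "c3 \<notin> u" and uK: "u \<subseteq> crossings K" using u new by auto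
  have n: "insert c3 u \<noteq> insert c2 v" for v using cu ne by (metis insertI1 insert_iff)
  have e: "v = u" if "insert c3 u = insert c3 v" "(v, l') \<in> states K" for v l'
    using that new cu by (auto simp: states_iff)
  \<comment> \<open>Both feet of the saddle lie on the upper horizontal arc, so it splits whatever
    the rest of the diagram is.\<close>
  have C: "(c, k + 1) \<in> circle K u (c, k + 2)" "(c, k + 2) \<in> circle K u (c, k + 2)"
    using circle_step(2)[OF circle_self dart_c(1), of u "k + 2"] over_c cu
    by (simp_all add: smoothing_simps circle_self)
  have m: "?m (c2, k + 2) = X_plus" "?m (c, k + 2) = X_minus" "?m (c3, k + 2) = l (c, k + 2)"
    "x \<in> darts K \<Longrightarrow> x \<noteq> (c, k + 1) \<Longrightarrow> x \<noteq> (c, k + 2) \<Longrightarrow> ?m x = l x" for x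
    by (cases x; auto simp: R_horizontal_def)+
  have "r2_map K c k c2 c3 a (insert c3 u, ?m) = (\<Sum>l'\<in>labelings K u. a (u, l') *
    saddle_coeff (darts K) (circle K u) (c, k + 2) (c, k + 1) (c, k + 2) (c3, k + 2) l' ?m)"
    unfolding r2_map_def linear_map_def using states_R_horizontal[OF l u] n e
    by (simp, subst sum_states[OF finite_K uK]) (auto simp: m split: prod.splits)
  also have "\<dots> = a (u, l) * comult_coeff (l (c, k + 2)) (?m (c, k + 2)) (?m (c3, k + 2))"
    by (rule sum_saddle_split[OF finite_K l _ C(1)]) (use C m in auto)
  finally show ?thesis by (simp add: m)
qed

lemma r2_map_vertical:
  assumes l: "l \<in> labelings K (insert c u)" and u: "u \<subseteq> crossings K - {c}"
  shows "r2_map K c k c2 c3 a (insert c2 (insert c u), R_vertical l) = a (insert c u, l)"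
proof -
  let ?v = "insert c u" and ?m = "R_vertical l"
  have cu: "c2 \<notin> ?v" "c3 \<notin> ?v" and uK: "?v \<subseteq> crossings K" using u new c by auto
  have n: "insert c2 ?v \<noteq> insert c3 v" for v using cu ne by (metis insertI1 insert_iff)
  have e: "v = ?v" if "insert c2 ?v = insert c2 v" "(v, l') \<in> states K" for v l'
    using that(1) insert_ident[of c2 ?v v] cu that(2) new by (auto simp: states_iff)
  have "r2_map K c k c2 c3 a (insert c2 ?v, ?m) = (\<Sum>l'\<in>labelings K ?v. a (?v, l') * of_bool (l = l'))"
    unfolding r2_map_def linear_map_def using states_R_vertical[OF l u] n
    by (simp, subst sum_states[OF finite_K uK])
      (auto simp: restrict_R_vertical[OF l] n split: prod.splits dest: e)
  also have "\<dots> = a (?v, l)"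
    using l finite_labelings[OF finite_K] by (subst sum_single[where x = l]) auto
  finally show ?thesis .
qed

text \<open>Off the \<open>(1,0)\<close>-summand the small circle always carries \<open>x_+\<close>,
  and the \<open>(0,0)\<close>- and \<open>(1,1)\<close>-components are zero.\<close>

lemma r2_map_eq_0:
  "c2 \<notin> w \<Longrightarrow> m (c2, k + 2) = X_minus \<Longrightarrow> r2_map K c k c2 c3 a (w, m) = 0"
  "c2 \<in> w \<longleftrightarrow> c3 \<in> w \<Longrightarrow> r2_map K c k c2 c3 a (w, m) = 0"
  unfolding r2_map_def linear_map_def using new
  by (auto intro!: sum.neutral simp: states_iff)


section \<open>The map of the saddle\<close>

text \<open>The circle between \<open>c2\<close> and \<open>c3\<close> merges into the lower arc. By
  the assumption on \<open>b\<close> it carries the unit \<open>x_+\<close>, so the other label is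
  unchanged.\<close>

lemma saddle_map_horizontal:
  assumes l: "l \<in> labelings K u" and u: "u \<subseteq> crossings K - {c}"
    and b: "\<And>m. m (c2, k + 2) = X_minus \<Longrightarrow> b (insert c3 u, m) = 0"
  shows "saddle_map R (c, k + 3) (c2, k + 2) b (insert c3 u, M_horizontal l a) =
    b (insert c3 u, R_horizontal l a X_plus)"
proof -
  let ?w = "insert c3 u" and ?d = "(c, k + 3)" and ?e = "(c3, k + 3)"
  let ?m = "M_horizontal l a" and ?l = "R_horizontal l a X_plus"
  have cu: "c \<notin> u" "c2 \<notin> u" "c3 \<notin> u" using u new by auto
  \<comment> \<open>These are the four darts of the circle between \<open>c2\<close> and
    \<open>c3\<close>.\<close>
  define S where "S = {(c3, k + 3), (c2, k + 2), (c2, k + 1), (c3, k)}"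
  have S: "S \<subseteq> circle R ?w ?e"
    using circle_step[of "(c3, k + 3)" R ?w ?e] circle_step[of "(c2, k + 2)" R ?w ?e]
      circle_step[of "(c2, k + 1)" R ?w ?e] cu
    by (simp add: S_def smoothing_simps over_R joined_R_new in_darts_R circle_self)
  \<comment> \<open>A labeling with different values at the two darts separates their circles, which
    avoids tracing the circle through the rest of the diagram.\<close>
  have ne: "?e \<notin> circle R ?w ?d"
  proof
    assume "?e \<in> circle R ?w ?d"
    from labelings_circle[OF R_horizontal_labelings[OF X_plus_labelings u] _ this]
    have "R_horizontal (\<lambda>_. X_plus) X_plus X_minus ?e = R_horizontal (\<lambda>_. X_plus) X_plus X_minus ?d"
      by (simp add: in_darts_R)
    then show False by (simp add: R_horizontal_def)
  qed
  have lm: "?m x = ?l x" if "x \<notin> S" for x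
    using that four_cases[of "snd x" k] by (cases x) (auto simp: S_def R_horizontal_def M_horizontal_def)
  have "saddle_map R ?d (c2, k + 2) b (?w, ?m) = (\<Sum>l'\<in>labelings R ?w. b (?w, l') *
      saddle_coeff (darts R) (circle R ?w) ?d ?e ?d ?e l' ?m)"
    using saddle_map_eq[OF finite_R, of ?w ?m ?d "(c2, k + 2)" b] states_M_horizontal[OF l u]
    by (simp add: saddle_R joined_R_new)
  also have "\<dots> = b (?w, ?l) * mult_coeff (?l ?d) (?l ?e) (?m ?d)"
  proof (rule sum_saddle_merge[OF finite_R R_horizontal_labelings[OF l u] _ _ ne])
    fix l' assume l': "l' \<in> labelings R ?w" "b (?w, l') \<noteq> 0" "mult_coeff (l' ?d) (l' ?e) (?m ?d) \<noteq> 0"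
    have "l' (c2, k + 2) = l' ?e"
      using labelings_circle[OF l'(1), of ?e "(c2, k + 2)"] S by (simp add: S_def in_darts_R)
    with b[of l'] l'(2) have "l' ?e = X_plus" by (metis label_neq(1))
    with l'(3) show "l' ?d = ?l ?d \<and> l' ?e = ?l ?e"
      by (simp add: R_horizontal_def M_horizontal_def)
  qed (use S lm in \<open>auto simp: in_darts_R\<close>)
  also have "\<dots> = b (?w, ?l)" by (simp add: R_horizontal_def M_horizontal_def)
  finally show ?thesis .
qed

text \<open>The saddle cuts the Hopf circle off the left strand, so it always splits. The source
  \<open>l'\<close> may differ from \<open>l\<close> on the circle of this strand, since the
  comultiplication can change the label that remains there.\<close>

lemma saddle_map_vertical_aux:
  assumes l: "l \<in> labelings K (insert c u)" and u: "u \<subseteq> crossings K - {c}"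
    and l': "l' \<in> labelings K (insert c u)"
    "\<And>x. x \<notin> circle K (insert c u) (c, k + 3) \<Longrightarrow> l' x = l x"
    and b: "\<And>b. b \<noteq> l' (c, k + 3) \<Longrightarrow> comult_coeff b a (l (c, k + 3)) = 0"
  shows "saddle_map R (c, k + 3) (c2, k + 2) b (insert c2 (insert c u), M_vertical l a) =
    b (insert c2 (insert c u), R_vertical l') * comult_coeff (l' (c, k + 3)) a (l (c, k + 3))"
proof -
  let ?w = "insert c2 (insert c u)" and ?d = "(c, k + 3)" and ?e = "(c3, k + 3)"
  let ?m = "M_vertical l a" and ?l = "R_vertical l'"
  let ?C = "circle R ?w ?d" and ?D = "circle K (insert c u) ?d"
  note strands = circle_R_strands[OF u, of ?d]
  have d: "?d \<in> ?C" by (rule circle_self)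
  have up: "up x \<notin> ?C \<Longrightarrow> x \<in> darts K \<Longrightarrow> l' x = l x" for x
    using circle_R_vertical[OF u, of x] l'(2) by blast
  have agree: "?m x = ?l x" if x: "x \<in> darts R" "x \<notin> ?C" for x
  proof (cases x)
    case (Pair y i)
    have up_y: "up (y, i) = (y, i)" if "y \<noteq> c" using that by (simp add: up_def)
    show ?thesis
      using x strands d four_cases[of i k] up[of "(c, k)"] up[of "(c, k + 1)"] up[of "(y, i)"] up_y
      by (auto simp: Pair M_vertical_def R_vertical_def in_darts_R up_def)
  qed
  have "saddle_map R ?d (c2, k + 2) b (?w, ?m) = (\<Sum>l'\<in>labelings R ?w. b (?w, l') *
      saddle_coeff (darts R) (circle R ?w) ?d ?e ?d ?e l' ?m)"
    using saddle_map_eq[OF finite_R, of ?w ?m ?d "(c2, k + 2)" b] states_M_vertical[OF l u]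
    by (simp add: saddle_R joined_R_new)
  also have "\<dots> = b (?w, ?l) * comult_coeff (?l ?d) (?m ?d) (?m ?e)"
    by (rule sum_saddle_split[OF finite_R R_vertical_labelings[OF l'(1) u]])
      (use strands d agree b in \<open>simp_all add: in_darts_R R_vertical_def M_vertical_def\<close>)
  finally show ?thesis by (simp add: R_vertical_def M_vertical_def)
qed

text \<open>If the cut-off circle carries \<open>x_-\<close>, the source label equals the label that
  remains. If it carries \<open>x_+\<close>, the source is \<open>x_+\<close>, with coefficient
  \<open>h\<close> or 1 according to whether \<open>x_+\<close> or \<open>x_-\<close>
  remains.\<close>

lemma saddle_map_vertical:
  assumes l: "l \<in> labelings K (insert c u)" and u: "u \<subseteq> crossings K - {c}"
  shows "saddle_map R (c, k + 3) (c2, k + 2) b (insert c2 (insert c u), M_vertical l X_minus) =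
      b (insert c2 (insert c u), R_vertical l)"
    and "saddle_map R (c, k + 3) (c2, k + 2) b (insert c2 (insert c u), M_vertical l X_plus) =
      (if l (c, k + 3) = X_plus then hvar * b (insert c2 (insert c u), R_vertical l)
       else b (insert c2 (insert c u),
         R_vertical (relabel l (circle K (insert c u) (c, k + 3)) X_plus)))"
proof -
  show "saddle_map R (c, k + 3) (c2, k + 2) b (insert c2 (insert c u), M_vertical l X_minus) =
      b (insert c2 (insert c u), R_vertical l)"
    by (subst saddle_map_vertical_aux[OF l u l]) auto
  let ?l = "relabel l (circle K (insert c u) (c, k + 3)) X_plus"
  have d: "?l (c, k + 3) = X_plus" by (simp add: relabel_def circle_self)
  have off: "?l x = l x" if "x \<notin> circle K (insert c u) (c, k + 3)" for x
    using that by (simp add: relabel_def)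
  show "saddle_map R (c, k + 3) (c2, k + 2) b (insert c2 (insert c u), M_vertical l X_plus) =
      (if l (c, k + 3) = X_plus then hvar * b (insert c2 (insert c u), R_vertical l)
       else b (insert c2 (insert c u), R_vertical ?l))"
    using relabel_same[OF l dart_c(1), of "k + 3" X_plus]
    by (subst saddle_map_vertical_aux[OF l u relabel_labelings[OF regular_K l dart_c(1)] off])
      (cases "l (c, k + 3)"; simp add: d)+
qed


section \<open>The projection from the connected sum\<close>

lemma crossings_K': "crossings K' = insert c3 (crossings K - {c})"
  using c(1) new by (auto simp: transpose_def)

lemma finite_K': "finite (crossings K')"
  by (simp add: finite_K)

lemma transpose_image:
  assumes "u \<subseteq> crossings K - {c}"
  shows "transpose c c3 ` u = u" "transpose c c3 ` insert c u = insert c3 u"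
proof -
  have "x \<noteq> c" "x \<noteq> c3" if "x \<in> u" for x using assms that new by auto
  then show "transpose c c3 ` u = u" "transpose c c3 ` insert c u = insert c3 u"
    by (simp_all cong: image_cong_simp)
qed

text \<open>The crossing change exchanges the resolutions, so horizontal arcs at \<open>c\<close> in
  \<open>K\<close> belong to vertices of \<open>K'\<close> containing \<open>c3\<close>, and
  vertical arcs to the others.\<close>

lemma states_K':
  assumes "u \<subseteq> crossings K - {c}"
  shows "l \<in> labelings K u \<Longrightarrow> (insert c3 u, l \<circ> t) \<in> states K'"
    "l \<in> labelings K (insert c u) \<Longrightarrow> (u, l \<circ> t) \<in> states K'"
proof -
  have "c \<notin> u" using assms by auto
  note L = labelings_crossing_change[OF this, of K]
  show "l \<in> labelings K u \<Longrightarrow> (insert c3 u, l \<circ> t) \<in> states K'"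
    using states_rename[of c c3 "insert c u" l "crossing_change c K"] assms c(1)
    by (auto simp: transpose_image[OF assms] states_iff L)
  show "l \<in> labelings K (insert c u) \<Longrightarrow> (u, l \<circ> t) \<in> states K'"
    using states_rename[of c c3 u l "crossing_change c K"] assms
    by (auto simp: transpose_image[OF assms] states_iff L)
qed

text \<open>By \<open>M_horizontal_unique\<close> a single labeling of \<open>M\<close> has the
  prescribed restriction and Hopf circle label.\<close>

lemma hopf_component_horizontal:
  assumes l: "l \<in> labelings K u" and u: "u \<subseteq> crossings K - {c}"
  shows "hopf_component K' (c3, k) c c2 {} e b (insert c3 u, l \<circ> t) = b (insert c3 u, M_horizontal l e)"
proof -
  let ?w = "insert c3 u"
  have w: "?w \<subseteq> crossings M" using u by auto
  have "hopf_component K' (c3, k) c c2 {} e b (?w, l \<circ> t) = (\<Sum>m\<in>labelings M ?w.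
      b (?w, m) * of_bool (restrict_labeling K' m = l \<circ> t \<and> m (c, k + 2) = e))"
    unfolding hopf_component_def linear_map_def using states_K'(1)[OF u l]
    by (simp del: rename_diagram_simps crossings_M, subst sum_states[OF finite_M w])
      (auto split: prod.splits)
  also have "\<dots> = b (?w, M_horizontal l e)"
  proof (subst sum_single[where x = "M_horizontal l e"])
    show "M_horizontal l e \<in> labelings M ?w" by (rule M_horizontal_labelings[OF l u])
    fix m assume "m \<in> labelings M ?w" "m \<noteq> M_horizontal l e"
    then show "b (?w, m) * of_bool (restrict_labeling K' m = l \<circ> t \<and> m (c, k + 2) = e) = 0"
      using M_horizontal_unique[OF _ l u, of m] by auto
  qed (use finite_labelings[OF finite_M] restrict_M[OF l] in \<open>simp_all add: M_horizontal_def\<close>)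
  finally show ?thesis .
qed

lemma hopf_component_vertical:
  assumes l: "l \<in> labelings K (insert c u)" and u: "u \<subseteq> crossings K - {c}"
  shows "hopf_component K' (c3, k) c c2 {c, c2} e b (u, l \<circ> t) =
    b (insert c2 (insert c u), M_vertical l e)"
proof -
  let ?w = "insert c2 (insert c u)"
  have w: "?w \<subseteq> crossings M" and uw: "u \<union> {c, c2} = ?w" using u c(1) by auto
  have "hopf_component K' (c3, k) c c2 {c, c2} e b (u, l \<circ> t) = (\<Sum>m\<in>labelings M ?w.
      b (?w, m) * of_bool (restrict_labeling K' m = l \<circ> t \<and> m (c, k + 2) = e))"
    unfolding hopf_component_def linear_map_def using states_K'(2)[OF u l]
    by (simp only: uw if_True, subst sum_states[OF finite_M w])
      (auto simp: insert_commute split: prod.splits)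
  also have "\<dots> = b (?w, M_vertical l e)"
  proof (subst sum_single[where x = "M_vertical l e"])
    show "M_vertical l e \<in> labelings M ?w" by (rule M_vertical_labelings[OF l u])
    fix m assume "m \<in> labelings M ?w" "m \<noteq> M_vertical l e"
    then show "b (?w, m) * of_bool (restrict_labeling K' m = l \<circ> t \<and> m (c, k + 2) = e) = 0"
      using M_vertical_unique[OF _ l u, of m] by auto
  qed (use finite_labelings[OF finite_M] restrict_M[OF l] in \<open>simp_all add: M_vertical_def\<close>)
  finally show ?thesis .
qed

lemma hopf_component_eq_0:
  "(\<And>m. b (v \<union> V, m) = 0) \<Longrightarrow> hopf_component K' (c3, k) c c2 V e b (v, l) = 0"
  unfolding hopf_component_def linear_map_def by (auto intro!: sum.neutral)


section \<open>The inclusion into the connected sum\<close>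

lemma not_in_crossings_K': "(v, l) \<in> states K' \<Longrightarrow> c \<notin> v \<and> c2 \<notin> v"
  using new c(1) by (auto simp: states_iff crossings_K' simp del: rename_diagram_simps)

lemma M_circle_label: "M_horizontal l a (c, k + 2) = a" "M_vertical l a (c, k + 2) = a"
  by (simp_all add: M_horizontal_def M_vertical_def)

lemma hopf_incl_horizontal:
  assumes l: "l \<in> labelings K u" and u: "u \<subseteq> crossings K - {c}"
  shows "hopf_incl K' (c3, k) c c2 {} e a (insert c3 u, M_horizontal l e') =
    of_bool (e' = e) * a (insert c3 u, l \<circ> t)"
proof -
  have w: "insert c3 u \<subseteq> crossings K'" and lt: "l \<circ> t \<in> labelings K' (insert c3 u)"
    using states_K'(1)[OF u l] by (simp_all only: states_iff)
  have "hopf_incl K' (c3, k) c c2 {} e a (insert c3 u, M_horizontal l e') =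
    (\<Sum>l'\<in>labelings K' (insert c3 u). a (insert c3 u, l') * of_bool (l \<circ> t = l' \<and> e' = e))"
    unfolding hopf_incl_def linear_map_def using states_M_horizontal[OF l u]
    by (simp only: if_True prod.case restrict_M[OF l], subst sum_states[OF finite_K' w])
      (auto simp: M_circle_label restrict_M[OF l] simp del: rename_diagram_simps split: prod.splits)
  also have "\<dots> = of_bool (e' = e) * a (insert c3 u, l \<circ> t)"
    using finite_labelings[OF finite_K'] lt by (subst sum_single[where x = "l \<circ> t"]) auto
  finally show ?thesis .
qed

lemma hopf_incl_vertical:
  assumes l: "l \<in> labelings K (insert c u)" and u: "u \<subseteq> crossings K - {c}"
  shows "hopf_incl K' (c3, k) c c2 {c, c2} e a (insert c2 (insert c u), M_vertical l e') =
    of_bool (e' = e) * a (u, l \<circ> t)"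
proof -
  have w: "u \<subseteq> crossings K'" and lt: "l \<circ> t \<in> labelings K' u"
    using states_K'(2)[OF u l] by (simp_all only: states_iff)
  have cu: "c \<notin> u" "c2 \<notin> u" using u new by auto
  \<comment> \<open>Vertices of \<open>K'\<close> avoid \<open>c\<close> and \<open>c2\<close>, so
    adjoining both is injective on them.\<close>
  have e: "insert c (insert c2 u) = insert c (insert c2 v) \<longleftrightarrow> v = u" if "(v, l') \<in> states K'" for v l'
  proof -
    have "v = insert c (insert c2 v) - {c, c2}" "u = insert c (insert c2 u) - {c, c2}"
      using not_in_crossings_K'[OF that] cu by auto
    then show ?thesis by metis
  qed
  have "hopf_incl K' (c3, k) c c2 {c, c2} e a (insert c2 (insert c u), M_vertical l e') =
    (\<Sum>l'\<in>labelings K' u. a (u, l') * of_bool (l \<circ> t = l' \<and> e' = e))"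
    unfolding hopf_incl_def linear_map_def using states_M_vertical[OF l u]
    by (simp only: if_True prod.case restrict_M[OF l], subst sum_states[OF finite_K' w])
      (auto simp: M_circle_label restrict_M[OF l] e insert_commute[of c2 c]
        simp del: rename_diagram_simps split: prod.splits)
  also have "\<dots> = of_bool (e' = e) * a (u, l \<circ> t)"
    using finite_labelings[OF finite_K'] lt by (subst sum_single[where x = "l \<circ> t"]) auto
  finally show ?thesis .
qed

lemma hopf_incl_eq_0:
  "c \<in> w \<or> c2 \<in> w \<Longrightarrow> hopf_incl K' (c3, k) c c2 {} e a (w, m) = 0"
  "c \<notin> w \<or> c2 \<notin> w \<Longrightarrow> hopf_incl K' (c3, k) c c2 {c, c2} e a (w, m) = 0"
  "m (c, k + 2) \<noteq> e \<Longrightarrow> hopf_incl K' (c3, k) c c2 V e a (w, m) = 0"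
  unfolding hopf_incl_def linear_map_def
  by (auto intro!: sum.neutral dest: not_in_crossings_K' simp del: rename_diagram_simps)

text \<open>Both Hopf crossings are 0-resolved here, so this is the summand of \<open>L_00\<close>,
  with \<open>x_p(a)\<close> at \<open>x_+\<close> and \<open>a\<close> at
  \<open>x_-\<close>.\<close>

lemma hopf_i_horizontal:
  assumes l: "l \<in> labelings K u" and u: "u \<subseteq> crossings K - {c}"
  shows "hopf_i K' (c3, k) c c2 a (insert c3 u, M_horizontal l X_plus) =
      x_map K' (c3, k) a (insert c3 u, l \<circ> t)"
    and "hopf_i K' (c3, k) c c2 a (insert c3 u, M_horizontal l X_minus) = a (insert c3 u, l \<circ> t)"
proof -
  have "c \<notin> insert c3 u" using u by auto
  then show "hopf_i K' (c3, k) c c2 a (insert c3 u, M_horizontal l X_plus) =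
      x_map K' (c3, k) a (insert c3 u, l \<circ> t)"
    "hopf_i K' (c3, k) c c2 a (insert c3 u, M_horizontal l X_minus) = a (insert c3 u, l \<circ> t)"
    by (simp_all add: hopf_i_def hopf_incl_eq_0 hopf_incl_horizontal[OF l u] del: rename_diagram_simps)
qed

lemma hopf_i_vertical:
  assumes l: "l \<in> labelings K (insert c u)" and u: "u \<subseteq> crossings K - {c}"
  shows "hopf_i K' (c3, k) c c2 a (insert c2 (insert c u), M_vertical l X_plus) = a (u, l \<circ> t)"
    and "m (c, k + 2) = X_minus \<Longrightarrow> hopf_i K' (c3, k) c c2 a (insert c2 (insert c u), m) = 0"
  by (simp_all add: hopf_i_def hopf_incl_eq_0 hopf_incl_vertical[OF l u] del: rename_diagram_simps)

lemma hopf_i_eq_0: "c \<in> w \<longleftrightarrow> c2 \<notin> w \<Longrightarrow> hopf_i K' (c3, k) c c2 a (w, m) = 0"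
  using hopf_incl_eq_0 by (auto simp: hopf_i_def simp del: rename_diagram_simps)


section \<open>The map of the inverse saddle\<close>

lemma joined_R_c: "joined R (c, k + 3) = up (joined K (c, k + 3))"
  using joined_R[of "(c, k + 3)"] by (simp add: up_def)

lemma joined_R_c_neq:
  "joined R (c, k + 3) \<noteq> (c, k + 3)" "joined R (c, k + 3) \<noteq> (c2, k + 2)"
  "joined R (c, k + 3) \<noteq> (c3, k + 3)"
  using joined_c(3) joined_neq[of "(c, k + 3)"] unfolding joined_R_c
  by (auto simp: up_def split: if_splits)

lemma saddle_M: "saddle (c, k + 3) (joined R (c, k + 3)) M = R"
proof -
  have inv: "joined R (joined R d) = d" if "d \<in> darts R" for d
    using regularD(3)[OF regular_R that] .
  show ?thesis
    unfolding saddle_R[symmetric]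
    by (rule saddle_saddle) (use joined_R_c_neq in \<open>auto simp: inv in_darts_R joined_R_new\<close>)
qed

text \<open>This locates the second foot of the inverse saddle as it enters
  \<open>saddle_map\<close>.\<close>

lemma joined_M_c: "joined M (joined R (c, k + 3)) = (c3, k + 3)"
  using joined_R_c_neq by (simp add: saddle_R[symmetric] saddle_def glue_def joined_R_new)

lemma saddle_M_map_eq:
  assumes "(w, m) \<in> states R"
  shows "saddle_map M (c, k + 3) (joined R (c, k + 3)) b (w, m) = (\<Sum>l\<in>labelings M w. b (w, l) *
      saddle_coeff (darts M) (circle M w) (c, k + 3) (c3, k + 3) (c, k + 3) (c3, k + 3) l m)"
  using saddle_map_eq[OF finite_M, of w m "(c, k + 3)" "joined R (c, k + 3)" b] assms
  by (simp only: saddle_M joined_M_c)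

text \<open>The inverse saddle splits the circle between \<open>c2\<close> and \<open>c3\<close> off
  the lower arc. With \<open>x_-\<close> on that circle, the coefficient is 1 and the label of the
  arc is kept.\<close>

lemma saddle_M_map_horizontal:
  assumes l: "l \<in> labelings K u" and u: "u \<subseteq> crossings K - {c}"
  shows "saddle_map M (c, k + 3) (joined R (c, k + 3)) b (insert c3 u, R_horizontal l a X_minus) =
    b (insert c3 u, M_horizontal l a)"
proof -
  let ?w = "insert c3 u" and ?d = "(c, k + 3)" and ?e = "(c3, k + 3)"
  let ?m = "R_horizontal l a X_minus" and ?l = "M_horizontal l a"
  have cu: "c2 \<notin> u" using u new by auto
  \<comment> \<open>In \<open>R\<close> these darts form the small circle; in \<open>M\<close> they
    lie on the lower arc, so the saddle is a split.\<close>
  define S where "S = {(c3, k + 3), (c2, k + 2), (c2, k + 1), (c3, k)}"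
  have S: "S \<subseteq> circle M ?w ?d"
    using circle_step[of "(c, k + 3)" M ?w ?d] circle_step[of "(c2, k + 2)" M ?w ?d]
      circle_step[of "(c2, k + 1)" M ?w ?d] circle_step[of "(c3, k)" M ?w ?d] cu
    by (simp add: S_def smoothing_simps over_M over_R joined_M_new in_darts_R darts_M circle_self)
  have lm: "?m x = ?l x" if "x \<notin> S" for x
    using that four_cases[of "snd x" k] by (cases x) (auto simp: S_def R_horizontal_def M_horizontal_def)
  have "saddle_map M ?d (joined R ?d) b (?w, ?m) = b (?w, ?l) * comult_coeff (?l ?d) (?m ?d) (?m ?e)"
    unfolding saddle_M_map_eq[OF states_R_horizontal[OF l u]]
  proof (rule sum_saddle_split[OF finite_M M_horizontal_labelings[OF l u]])
    show "?m x = ?l x" if "x \<notin> circle M ?w ?d" for x using that S lm by blast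
  qed (use S in \<open>auto simp: S_def darts_M in_darts_R R_horizontal_def M_horizontal_def\<close>)
  then show ?thesis by (simp add: R_horizontal_def M_horizontal_def)
qed

text \<open>The Hopf circle merges back into the left strand; the assumption on \<open>b\<close>
  puts the unit \<open>x_+\<close> on it.\<close>

lemma saddle_M_map_vertical:
  assumes l: "l \<in> labelings K (insert c u)" and u: "u \<subseteq> crossings K - {c}"
    and b: "\<And>m. m (c, k + 2) = X_minus \<Longrightarrow> b (insert c2 (insert c u), m) = 0"
  shows "saddle_map M (c, k + 3) (joined R (c, k + 3)) b (insert c2 (insert c u), R_vertical l) =
    b (insert c2 (insert c u), M_vertical l X_plus)"
proof -
  let ?w = "insert c2 (insert c u)" and ?d = "(c, k + 3)" and ?e = "(c3, k + 3)"
  let ?m = "R_vertical l" and ?l = "M_vertical l X_plus"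
  define S where "S = {(c, k + 3), (c2, k + 2), (c2, k + 3), (c, k + 2)}"
  have S: "S \<subseteq> circle M ?w ?d"
    using circle_step[of "(c, k + 3)" M ?w ?d] circle_step[of "(c2, k + 2)" M ?w ?d]
      circle_step[of "(c2, k + 3)" M ?w ?d]
    by (simp add: S_def smoothing_simps over_M over_R joined_M_new in_darts_R darts_M circle_self)
  have ne: "?e \<notin> circle M ?w ?d"
  proof
    assume "?e \<in> circle M ?w ?d"
    from labelings_circle[OF M_vertical_labelings[OF X_plus_labelings u] _ this]
    have "M_vertical (\<lambda>_. X_plus) X_minus ?e = M_vertical (\<lambda>_. X_plus) X_minus ?d"
      by (simp add: in_darts_R darts_M)
    then show False by (simp add: M_vertical_def)
  qed
  have lm: "?m x = ?l x" if "x \<notin> S" for x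
    using that four_cases[of "snd x" k] by (cases x) (auto simp: S_def R_vertical_def M_vertical_def)
  have "saddle_map M ?d (joined R ?d) b (?w, ?m) = b (?w, ?l) * mult_coeff (?l ?d) (?l ?e) (?m ?d)"
    unfolding saddle_M_map_eq[OF states_R_vertical[OF l u]]
  proof (rule sum_saddle_merge[OF finite_M M_vertical_labelings[OF l u] _ _ ne])
    fix l' assume l': "l' \<in> labelings M ?w" "b (?w, l') \<noteq> 0" "mult_coeff (l' ?d) (l' ?e) (?m ?d) \<noteq> 0"
    have "l' (c, k + 2) = l' ?d"
      using labelings_circle[OF l'(1), of ?d "(c, k + 2)"] S by (simp add: S_def in_darts_R darts_M)
    with b[of l'] l'(2) have "l' ?d = X_plus" by (metis label_neq(1))
    with l'(3) show "l' ?d = ?l ?d \<and> l' ?e = ?l ?e"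
      by (simp add: R_vertical_def M_vertical_def)
  qed (use S lm in \<open>auto simp: in_darts_R darts_M\<close>)
  then show ?thesis by (simp add: R_vertical_def M_vertical_def)
qed

lemma r2_inverse_map_vertical:
  assumes l: "l \<in> labelings K (insert c u)" and u: "u \<subseteq> crossings K - {c}"
    and b: "\<And>m. b (insert c3 (insert c u), m) = 0"
  shows "r2_inverse_map K c k c2 c3 b (insert c u, l) = b (insert c2 (insert c u), R_vertical l)"
proof -
  let ?w = "insert c2 (insert c u)"
  have w: "?w \<subseteq> crossings R" and uK: "(insert c u, l) \<in> states K"
    using l u c(1) by (auto simp: states_iff)
  have "r2_inverse_map K c k c2 c3 b (insert c u, l) =
      (\<Sum>m\<in>labelings R ?w. b (?w, m) * of_bool (restrict_labeling K m = l))"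
    unfolding r2_inverse_map_def linear_map_def using uK b
    by (simp del: crossings_R, subst sum_states[OF finite_R w]) (auto split: prod.splits)
  also have "\<dots> = b (?w, R_vertical l)"
  proof (subst sum_single[where x = "R_vertical l"])
    fix m assume "m \<in> labelings R ?w" "m \<noteq> R_vertical l"
    then show "b (?w, m) * of_bool (restrict_labeling K m = l) = 0"
      using R_vertical_unique[OF _ l u, of m] by auto
  qed (use finite_labelings[OF finite_R] restrict_R_vertical[OF l] R_vertical_labelings[OF l u]
      in simp_all)
  finally show ?thesis .
qed

text \<open>The counit forces \<open>x_-\<close> on the small circle, and the saddle merges the
  circle above \<open>c\<close>, labelled \<open>x\<close>, into the circle of the upper arc,
  labelled \<open>y\<close>. Elsewhere the labels are those of \<open>l\<close>, whence four
  candidates.\<close>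

lemma r2_inverse_map_horizontal:
  fixes l u
  defines "C \<equiv> circle K u (c, k + 2)"
  assumes l: "l \<in> labelings K u" and u: "u \<subseteq> crossings K - {c}"
    and b: "\<And>m. b (insert c2 u, m) = 0"
  shows "r2_inverse_map K c k c2 c3 b (u, l) =
    (\<Sum>(x, y)\<in>UNIV. b (insert c3 u, R_horizontal (relabel l C y) x X_minus) *
      mult_coeff x y (l (c, k + 2)))"
proof -
  let ?w = "insert c3 u" and ?d = "(c, k + 2)" and ?e = "(c3, k + 2)"
  let ?R = "\<lambda>(x, y). R_horizontal (relabel l C y) x X_minus"
  let ?F = "\<lambda>m. b (?w, m) * (counit (m (c2, k + 2)) *
    saddle_coeff (darts K) (circle R ?w) ?d ?e ?d (c, k + 1) m l)"
  have cu: "c \<notin> u" "c2 \<notin> u" "c3 \<notin> u" using u new by auto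
  have w: "?w \<subseteq> crossings R" and uK: "(u, l) \<in> states K"
    using l u c(1) by (auto simp: states_iff)
  have n: "?w \<noteq> insert c2 v" for v using cu ne by (metis insertI1 insert_iff)
  have lR: "?R xy \<in> labelings R ?w" for xy
    using R_horizontal_labelings[OF relabel_labelings[OF regular_K l dart_c(1)] u]
    by (cases xy) (simp add: C_def)
  have Rv: "?R xy ?d = fst xy" "?R xy ?e = snd xy" "?R xy (c2, k + 2) = X_minus" for xy
    by (cases xy; simp add: R_horizontal_def relabel_def C_def circle_self)+
  have ne: "?e \<notin> circle R ?w ?d"
  proof
    assume "?e \<in> circle R ?w ?d"
    from labelings_circle[OF R_horizontal_labelings[OF X_plus_labelings u] _ this]
    have "R_horizontal (\<lambda>_. X_plus) X_minus X_plus ?e = R_horizontal (\<lambda>_. X_plus) X_minus X_plus ?d"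
      by (simp add: in_darts_R)
    then show False by (simp add: R_horizontal_def)
  qed
  have d: "(c, k + 1) \<in> circle R ?w ?d" "(c2, k) \<in> circle R ?w ?d" "(c2, k + 3) \<in> circle R ?w ?d"
    "(c, k + 2) \<in> circle R ?w ?d" "(c3, k + 1) \<in> circle R ?w ?e" "(c3, k + 2) \<in> circle R ?w ?e"
    using circle_step[of "(c, k + 2)" R ?w ?d] circle_step[of "(c, k + 1)" R ?w ?d]
      circle_step[of "(c3, k + 2)" R ?w ?e] cu over_c
    by (simp_all add: smoothing_simps over_R joined_R_new in_darts_R circle_self)
  \<comment> \<open>The relabeled circle \<open>C\<close> is carried by \<open>up\<close> into the
    circle of the upper arc, so it is not seen off the two merging circles.\<close>
  have agree: "?R xy x = l x"
    if "x \<in> darts K" "x \<notin> circle R ?w ?d" "x \<notin> circle R ?w ?e" for x xy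
  proof -
    have x: "x \<noteq> (c, k + 1)" "x \<noteq> (c, k + 2)" using that d by auto
    then have "x \<notin> C" using circle_R_horizontal[OF u, of x] that unfolding C_def up_def by auto
    then show ?thesis using x that(1)
      by (cases xy; cases x) (auto simp: R_horizontal_def relabel_def)
  qed
  have inner: "m (c2, k + 1) = m (c2, k + 2)" "m (c3, k) = m (c2, k + 2)" "m (c3, k + 3) = m (c2, k + 2)"
    if m: "m \<in> labelings R ?w" for m
  proof -
    have 3: "\<forall>x\<in>crossings K - {c}. x \<in> insert c3 u \<longleftrightarrow> x \<in> u" using new by auto
    show "m (c2, k + 1) = m (c2, k + 2)" "m (c3, k) = m (c2, k + 2)" "m (c3, k + 3) = m (c2, k + 2)"
      using m[unfolded labelings_R[OF 3]] cu by (auto simp: smooth_at_def)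
  qed
  have "r2_inverse_map K c k c2 c3 b (u, l) = sum ?F (labelings R ?w)"
    unfolding r2_inverse_map_def linear_map_def using uK b n cu
    by (simp del: crossings_R, subst sum_states[OF finite_R w]) (auto split: prod.splits)
  also have "\<dots> = (\<Sum>xy\<in>UNIV. ?F (?R xy))"
  proof (rule sum_support)
    show "inj ?R"
      by (rule inj_on_inverseI[where g = "\<lambda>m. (m ?d, m ?e)"]) (simp only: Rv prod.collapse)
    fix m assume m: "m \<in> labelings R ?w" "m \<notin> range ?R"
    show "?F m = 0"
    proof (rule ccontr)
      assume "?F m \<noteq> 0"
      then have m': "m (c2, k + 2) = X_minus" "\<forall>x\<in>darts K - circle R ?w ?d - circle R ?w ?e. l x = m x"
        by (auto simp: saddle_coeff_def) (metis counit.simps(1) label_neq(1))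
      have "m = ?R (m ?d, m ?e)"
      proof (rule labeling_eqI[OF m(1) lR, of ?d ?e])
        fix x assume x: "x \<in> darts R" "x \<notin> circle R ?w ?d" "x \<notin> circle R ?w ?e"
        show "m x = ?R (m ?d, m ?e) x"
        proof (cases "x \<in> darts K")
          case True
          then show ?thesis using m'(2) x agree[OF True x(2,3)] by auto
        next
          case False
          then show ?thesis
            using x d m'(1) inner[OF m(1)] inner[OF lR] Rv(3) four_cases[of "snd x" k]
            by (cases x) (auto simp: in_darts_R)
        qed
      qed (simp_all only: Rv fst_conv snd_conv, simp_all add: in_darts_R)
      with m(2) show False by blast
    qed
  qed (use finite_labelings[OF finite_R] lR in auto)
  also have "\<dots> = (\<Sum>(x, y)\<in>UNIV. b (?w, ?R (x, y)) * mult_coeff x y (l ?d))"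
  proof (rule sum.cong)
    fix xy :: "label \<times> label"
    have "\<forall>x\<in>darts K - circle R ?w ?d - circle R ?w ?e. l x = ?R xy x"
      using agree[of _ xy] by (metis DiffD1 DiffD2)
    from saddle_coeff_merge[where C = "circle R ?w", OF ne this]
    have "saddle_coeff (darts K) (circle R ?w) ?d ?e ?d (c, k + 1) (?R xy) l =
        mult_coeff (fst xy) (snd xy) (l ?d)"
      unfolding Rv(1,2) .
    then show "?F (?R xy) = (case xy of (x, y) \<Rightarrow> b (?w, ?R (x, y)) * mult_coeff x y (l ?d))"
      using Rv(3)[of xy] by (cases xy) simp
  qed simp
  finally show ?thesis by (simp only: prod.case)
qed


section \<open>The crossing change maps\<close>

text \<open>Undoing the renaming and then the crossing change brings the Hopf basepoint
  \<open>(c3, k)\<close> back to \<open>(c, k)\<close> in \<open>K\<close>.\<close>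

lemma x_map_K':
  assumes u: "u \<subseteq> crossings K - {c}"
  shows "x_map K' (c3, k) a (insert c3 u, l \<circ> t) = x_map K (c, k) (\<lambda>(v, l). a (insert c3 v, l \<circ> t)) (u, l)"
    and "x_map K' (c3, k) a (u, l \<circ> t) = x_map K (c, k) (\<lambda>(v, l). a (v - {c}, l \<circ> t)) (insert c u, l)"
proof -
  have cu: "c \<notin> u" using u by auto
  note reg = regular_crossing_change[OF regular_K, of c]
  have "x_map K' (t (c, k)) a (transpose c c3 ` v, l \<circ> t) =
      x_map (crossing_change c K) (c, k) (rename_chain c c3 a) (v, l)" for v
    by (rule x_map_rename[OF reg]) simp
  note * = this[of "insert c u"] this[of u]
  show "x_map K' (c3, k) a (insert c3 u, l \<circ> t) = x_map K (c, k) (\<lambda>(v, l). a (insert c3 v, l \<circ> t)) (u, l)"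
    using *(1) x_map_crossing_change(2)[OF regular_K dart_c(1) c(1) cu, of k "rename_chain c c3 a" l]
      x_map_cong[OF regular_K dart_c(1), of u "\<lambda>(w, l). rename_chain c c3 a (insert c w, l)"
        "\<lambda>(v, l). a (insert c3 v, l \<circ> t)" k l]
    by (simp only: transpose_image[OF u] rename_chain_def prod.case) (simp add: t_Pair transpose_image[OF u])
  show "x_map K' (c3, k) a (u, l \<circ> t) = x_map K (c, k) (\<lambda>(v, l). a (v - {c}, l \<circ> t)) (insert c u, l)"
    using *(2) x_map_crossing_change(1)[OF regular_K dart_c(1) c(1) cu, of k "rename_chain c c3 a" l]
      x_map_cong[OF regular_K dart_c(1), of "insert c u" "\<lambda>(w, l). rename_chain c c3 a (w - {c}, l)"
        "\<lambda>(v, l). a (v - {c}, l \<circ> t)" k l] cu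
    by (simp only: transpose_image[OF u] rename_chain_def prod.case) (simp add: t_Pair transpose_image[OF u])
qed

text \<open>In either resolution opposite darts lie on different arcs at \<open>c\<close>, so by
  sliding basepoints the sum does not depend on the strand chosen for \<open>p\<close>.\<close>

lemma x_map_opposite:
  assumes "fst p = c"
  shows "c \<in> v \<Longrightarrow> x_map K p a (v, l) + x_map K (opposite p) a (v, l) =
      x_map K (c, k) a (v, l) + x_map K (c, k + 3) a (v, l)"
    and "c \<notin> v \<Longrightarrow> x_map K p a (v, l) + x_map K (opposite p) a (v, l) =
      x_map K (c, k) a (v, l) + x_map K (c, k + 2) a (v, l)"
proof -
  obtain i where p: "p = (c, i)" using assms by (cases p) auto
  have 1: "x_map K (smoothing K v (c, k)) a (v, l) = x_map K (c, k) a (v, l)"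
    "x_map K (smoothing K v (c, k + 2)) a (v, l) = x_map K (c, k + 2) a (v, l)"
    by (rule x_map_smoothing[OF regular_K dart_c(1)])+
  show "x_map K p a (v, l) + x_map K (opposite p) a (v, l) =
      x_map K (c, k) a (v, l) + x_map K (c, k + 3) a (v, l)" if "c \<in> v"
    using four_cases[of i k] 1 over_c that by (elim disjE)
      (simp_all add: p smoothing_simps add.commute[where 'a = "bit poly"])
  show "x_map K p a (v, l) + x_map K (opposite p) a (v, l) =
      x_map K (c, k) a (v, l) + x_map K (c, k + 2) a (v, l)" if "c \<notin> v"
    using four_cases[of i k] 1 over_c that by (elim disjE)
      (simp_all add: p smoothing_simps add.commute[where 'a = "bit poly"])
qed

lemma crossing_change_positive:
  assumes a: "a \<in> bar_natan K" and p: "fst p = c"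
  shows "crossing_change_map K c p (opposite p) a =
    (rename_chain c c3 \<circ> hopf_p K' (c3, k) c c2 \<circ> saddle_map R (c, k + 3) (c2, k + 2)
      \<circ> r2_map K c k c2 c3) a"
proof (rule ext, clarify)
  fix v l
  define A where "A = r2_map K c k c2 c3 a"
  define B where "B = saddle_map R (c, k + 3) (c2, k + 2) A"
  let ?comp = "\<lambda>V e. hopf_component K' (c3, k) c c2 V e B"
  \<comment> \<open>The Reidemeister map reaches vertices with exactly one of \<open>c2\<close>,
    \<open>c3\<close>, and the saddle keeps the vertex. Hence each vertex of \<open>K'\<close> sees
    only one of the Hopf summands \<open>L_00\<close> and \<open>L_11\<close>.\<close>
  have A0: "A (w, m) = 0" if "c2 \<in> w \<longleftrightarrow> c3 \<in> w" for w m
    unfolding A_def using r2_map_eq_0(2)[OF that] .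
  have B0: "B (w, m) = 0" if "c2 \<in> w \<longleftrightarrow> c3 \<in> w" for w m
    unfolding B_def using A0[OF that] by (rule saddle_map_eq_0)
  have rhs: "(rename_chain c c3 \<circ> hopf_p K' (c3, k) c c2 \<circ> saddle_map R (c, k + 3) (c2, k + 2)
      \<circ> r2_map K c k c2 c3) a (v, l) = hopf_p K' (c3, k) c c2 B (transpose c c3 ` v, l \<circ> t)"
    by (simp add: rename_chain_def B_def A_def)
  have pd: "p \<in> darts K" "opposite p \<in> darts K" using p by (cases p; simp)+
  have regK': "regular K'"
    by (intro regular_rename regular_crossing_change regular_K)
  have c3K': "(c3, k) \<in> darts K'" by (simp add: in_darts_rename t_Pair)
  show "crossing_change_map K c p (opposite p) a (v, l) =
    (rename_chain c c3 \<circ> hopf_p K' (c3, k) c c2 \<circ> saddle_map R (c, k + 3) (c2, k + 2)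
      \<circ> r2_map K c k c2 c3) a (v, l)"
  proof (cases "(v, l) \<in> states (crossing_change c K)")
    case False
    then have "(transpose c c3 ` v, l \<circ> t) \<notin> states K'" by (simp add: states_rename)
    then have "hopf_p K' (c3, k) c c2 B (transpose c c3 ` v, l \<circ> t) = 0"
      by (simp add: hopf_p_def hopf_component_def linear_map_def x_map_eq[OF regK' c3K']
        del: rename_diagram_simps)
    with crossing_change_map_outside[OF regular_K pd c(1) a False] rhs show ?thesis by simp
  next
    case s: True
    show ?thesis
    proof (cases "c \<in> v")
      case True
      \<comment> \<open>For \<open>K_-\<close>, having \<open>c\<close> in the vertex means
        horizontal arcs, where the map is the identity.\<close>
      define u where "u = v - {c}"
      have v: "v = insert c u" and cu: "c \<notin> u" using True by (auto simp: u_def)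
      have u: "u \<subseteq> crossings K - {c}" and l: "l \<in> labelings K u"
        using s cu by (auto simp: v states_iff labelings_crossing_change)
      have c2u: "c2 \<notin> insert c3 u" using u new by auto
      have 0: "?comp {c, c2} e (insert c3 u, l') = 0" for e l'
        by (rule hopf_component_eq_0, rule B0) simp
      have "?comp {} X_minus (insert c3 u, l \<circ> t) = B (insert c3 u, M_horizontal l X_minus)"
        by (rule hopf_component_horizontal[OF l u])
      also have "\<dots> = A (insert c3 u, R_horizontal l X_minus X_plus)"
        unfolding B_def
        by (rule saddle_map_horizontal[OF l u], unfold A_def, rule r2_map_eq_0(1)[OF c2u])
      also have "\<dots> = a (u, l)"
        unfolding A_def by (rule r2_map_horizontal[OF l u])
      finally have "hopf_p K' (c3, k) c c2 B (insert c3 u, l \<circ> t) = a (u, l)"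
        by (simp add: hopf_p_def 0 x_map_eq[OF regK' c3K'] del: rename_diagram_simps)
      then show ?thesis
        unfolding rhs unfolding v transpose_image[OF u] using cu by (simp add: crossing_change_map_def)
    next
      case False
      then have u: "v \<subseteq> crossings K - {c}" and l: "l \<in> labelings K (insert c v)"
        using s by (auto simp: states_iff labelings_crossing_change)
      have cu: "c2 \<notin> v" "c3 \<notin> v" using u new by auto
      let ?v = "insert c v"
      have 0: "?comp {} e (v, l') = 0" for e l'
        by (rule hopf_component_eq_0, rule B0) (simp add: cu)
      have AV: "A (insert c2 ?v, R_vertical l') = a (?v, l')" if "l' \<in> labelings K ?v" for l'
        unfolding A_def by (rule r2_map_vertical[OF that u])
      have minus: "?comp {c, c2} X_minus (v, l' \<circ> t) = a (?v, l')" if l': "l' \<in> labelings K ?v" for l'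
        unfolding hopf_component_vertical[OF l' u] B_def saddle_map_vertical(1)[OF l' u] AV[OF l'] ..
      have plus: "?comp {c, c2} X_plus (v, l \<circ> t) = (if l (c, k + 3) = X_plus then hvar * a (?v, l)
          else a (?v, relabel l (circle K ?v (c, k + 3)) X_plus))"
        unfolding hopf_component_vertical[OF l u] B_def saddle_map_vertical(2)[OF l u]
        using AV[OF l] AV[OF relabel_labelings[OF regular_K l dart_c(1)]] by simp
      have x: "x_map K' (c3, k) (?comp {c, c2} X_minus) (v, l \<circ> t) = x_map K (c, k) a (?v, l)"
        unfolding x_map_K'(2)[OF u]
        by (rule x_map_cong[OF regular_K dart_c(1)])
          (simp add: minus False del: rename_diagram_simps)
      have vl: "(?v, l) \<in> states K" using l u c(1) by (auto simp: states_iff)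
      \<comment> \<open>If the left strand carries \<open>x_+\<close>, the \<open>h\<close> from the
        comultiplication cancels the \<open>h\<close> in \<open>hopf_p\<close>. If it carries
        \<open>x_-\<close>, the two remaining terms are the action of \<open>x_-\<close> on that
        strand.\<close>
      have "hopf_p K' (c3, k) c c2 B (v, l \<circ> t) =
          x_map K (c, k) a (?v, l) + x_map K (c, k + 3) a (?v, l)"
        using vl add_self_bit_poly[of "hvar * a (?v, l)"]
        by (simp add: hopf_p_def 0 plus minus[OF l] x x_map_eq[OF regular_K dart_c(1), of "k + 3"]
            ac_simps del: rename_diagram_simps)
      also have "\<dots> = x_map K p a (?v, l) + x_map K (opposite p) a (?v, l)"
        using x_map_opposite(1)[OF p, of ?v a l] by simp
      finally show ?thesis
        unfolding rhs transpose_image[OF u] using False by (simp add: crossing_change_map_def)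
    qed
  qed
qed

lemma crossing_change_negative:
  assumes a: "a \<in> bar_natan (crossing_change c K)" and p: "fst p = c"
  shows "crossing_change_map (crossing_change c K) c p (opposite p) a =
    (r2_inverse_map K c k c2 c3 \<circ> saddle_map M (c, k + 3) (joined R (c, k + 3))
      \<circ> hopf_i K' (c3, k) c c2 \<circ> rename_chain c c3) a"
proof (rule ext, clarify)
  fix v l
  define A where "A = rename_chain c c3 a"
  define B where "B = hopf_i K' (c3, k) c c2 A"
  define D where "D = saddle_map M (c, k + 3) (joined R (c, k + 3)) B"
  \<comment> \<open>\<open>hopf_i\<close> reaches only vertices at which \<open>c\<close> and
    \<open>c2\<close> are resolved alike, and the saddle keeps them. So at each vertex of
    \<open>K\<close> only one component of \<open>r2_inverse_map\<close> contributes.\<close>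
  have D0: "D (w, m) = 0" if "c \<in> w \<longleftrightarrow> c2 \<notin> w" for w m
    unfolding D_def B_def using hopf_i_eq_0[OF that] by (rule saddle_map_eq_0)
  have rhs: "(r2_inverse_map K c k c2 c3 \<circ> saddle_map M (c, k + 3) (joined R (c, k + 3))
      \<circ> hopf_i K' (c3, k) c c2 \<circ> rename_chain c c3) a (v, l) = r2_inverse_map K c k c2 c3 D (v, l)"
    by (simp add: A_def B_def D_def)
  have pd: "p \<in> darts K" "opposite p \<in> darts K" using p by (cases p; simp)+
  show "crossing_change_map (crossing_change c K) c p (opposite p) a (v, l) =
    (r2_inverse_map K c k c2 c3 \<circ> saddle_map M (c, k + 3) (joined R (c, k + 3))
      \<circ> hopf_i K' (c3, k) c c2 \<circ> rename_chain c c3) a (v, l)"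
  proof (cases "(v, l) \<in> states K")
    case False
    then have "r2_inverse_map K c k c2 c3 D (v, l) = 0"
      by (simp add: r2_inverse_map_def linear_map_def)
    moreover have "crossing_change_map (crossing_change c K) c p (opposite p) a (v, l) = 0"
      by (rule crossing_change_map_outside[OF regular_crossing_change[OF regular_K] _ _ _ a])
        (use pd c(1) False in \<open>simp_all add: crossing_change_involution\<close>)
    ultimately show ?thesis using rhs by simp
  next
    case s: True
    show ?thesis
    proof (cases "c \<in> v")
      case True
      define u where "u = v - {c}"
      have v: "v = insert c u" and cu: "c \<notin> u" using True by (auto simp: u_def)
      have u: "u \<subseteq> crossings K - {c}" and l: "l \<in> labelings K (insert c u)"
        using s cu by (auto simp: v states_iff)
      have c2u: "c2 \<notin> u" using u new by auto
      have "r2_inverse_map K c k c2 c3 D (insert c u, l) = D (insert c2 (insert c u), R_vertical l)"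
        by (rule r2_inverse_map_vertical[OF l u], rule D0) (simp add: c2u)
      also have "\<dots> = B (insert c2 (insert c u), M_vertical l X_plus)"
        unfolding D_def B_def
        by (rule saddle_M_map_vertical[OF l u], rule hopf_i_vertical(2)[OF l u])
      also have "\<dots> = a (u, l)"
        unfolding B_def hopf_i_vertical(1)[OF l u] A_def rename_chain_def
        by (simp add: transpose_image[OF u])
      finally show ?thesis
        unfolding rhs unfolding v using cu by (simp add: crossing_change_map_def)
    next
      case False
      then have u: "v \<subseteq> crossings K - {c}" and l: "l \<in> labelings K v"
        using s by (auto simp: states_iff)
      let ?a = "\<lambda>(v, l). a (insert c v, l)"
      have Aa: "A (insert c3 v, l' \<circ> t) = a (insert c v, l')" for l'
        unfolding A_def rename_chain_def transpose_image(2)[OF u, symmetric]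
        by (simp add: image_image)
      have "D (insert c3 v, R_horizontal l' x X_minus) = B (insert c3 v, M_horizontal l' x)"
        if "l' \<in> labelings K v" for l' x
        unfolding D_def by (rule saddle_M_map_horizontal[OF that u])
      moreover have "B (insert c3 v, M_horizontal l' X_plus) = x_map K (c, k) ?a (v, l')"
        if "l' \<in> labelings K v" for l'
        unfolding B_def hopf_i_horizontal(1)[OF that u] x_map_K'(1)[OF u]
        by (rule x_map_cong[OF regular_K dart_c(1)]) (simp add: Aa)
      moreover have "B (insert c3 v, M_horizontal l' X_minus) = ?a (v, l')"
        if "l' \<in> labelings K v" for l'
        unfolding B_def hopf_i_horizontal(2)[OF that u] by (simp add: Aa)
      ultimately have DR: "D (insert c3 v, R_horizontal l' X_plus X_minus) = x_map K (c, k) ?a (v, l')"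
        "D (insert c3 v, R_horizontal l' X_minus X_minus) = ?a (v, l')"
        if "l' \<in> labelings K v" for l'
        using that by auto
      have UNIV: "(UNIV :: (label \<times> label) set) =
          {(X_plus, X_plus), (X_plus, X_minus), (X_minus, X_plus), (X_minus, X_minus)}"
        unfolding UNIV_Times_UNIV[symmetric] UNIV_label by auto
      let ?C = "circle K v (c, k + 2)"
      note rl = relabel_labelings[OF regular_K l dart_c(1), of "k + 2"]
      have "r2_inverse_map K c k c2 c3 D (v, l) =
        (\<Sum>(x, y)\<in>UNIV. D (insert c3 v, R_horizontal (relabel l ?C y) x X_minus) *
          mult_coeff x y (l (c, k + 2)))"
        by (rule r2_inverse_map_horizontal[OF l u], rule D0) (simp add: False)
      \<comment> \<open>Terms with \<open>x_+\<close> on the merged circle give the basepoint action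
        on the lower arc. Those with \<open>x_-\<close>, where the chain itself appears, give the
        action on the upper arc.\<close>
      also have "\<dots> = x_map K (c, k) ?a (v, l) + x_map K (c, k + 2) ?a (v, l)"
        using relabel_same[OF l dart_c(1), of "k + 2"] s
        by (cases "l (c, k + 2)")
          (simp_all add: UNIV DR[OF rl] x_map_eq[OF regular_K dart_c(1), of "k + 2"] ac_simps)
      also have "\<dots> = x_map K p ?a (v, l) + x_map K (opposite p) ?a (v, l)"
        using x_map_opposite(2)[OF p False, of ?a l] by (rule sym)
      also have "\<dots> = x_map (crossing_change c K) p a (insert c v, l) +
          x_map (crossing_change c K) (opposite p) a (insert c v, l)"
        using x_map_crossing_change(2)[OF regular_K _ c(1) False] pd by simp
      finally show ?thesis
        unfolding rhs using False by (simp add: crossing_change_map_def)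
    qed
  qed
qed

end

theorem theorem4p1:
  fixes K K_minus K_minus' K_tilde L :: "'c diagram"
    and c c2 c3 :: 'c and k :: 4 and p q :: "'c dart"
  assumes "knot_diagram K"
    and "c \<in> crossings K" and "positive_crossing K c"
    and "over K (c, k)" and "inward K (c, k)"
    and "c2 \<notin> crossings K" and "c3 \<notin> crossings K" and "c2 \<noteq> c3"
    and "fst p = c" and "q = opposite p"
    and "K_minus = crossing_change c K"
    and "K_minus' = rename_diagram c c3 K_minus"
    and "K_tilde = r2_diagram K c k c2 c3"
    and "L = saddle (c, k + 3) (c2, k + 2) K_tilde"
  shows "(\<forall>a \<in> bar_natan K.
            crossing_change_map K c p q a =
            (rename_chain c c3 \<circ> hopf_p K_minus' (c3, k) c c2
              \<circ> saddle_map K_tilde (c, k + 3) (c2, k + 2)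
              \<circ> r2_map K c k c2 c3) a) \<and>
         (\<forall>a \<in> bar_natan K_minus.
            crossing_change_map K_minus c p q a =
            (r2_inverse_map K c k c2 c3
              \<circ> saddle_map L (c, k + 3) (joined K_tilde (c, k + 3))
              \<circ> hopf_i K_minus' (c3, k) c c2 \<circ> rename_chain c c3) a)"
proof -
  have link: "link_diagram K" using assms(1) by (simp add: knot_diagram_def)
  then have regular: "regular K" by (rule link_diagram_regular)
  obtain j where j: "over K (c, j)" "inward K (c, j)" "inward K (c, j + 1)"
    using assms(3) by (auto simp: positive_crossing_def)
  have "inward K (opposite (c, j)) \<longleftrightarrow> \<not> inward K (c, j)"
    using link assms(2) unfolding link_diagram_def by (metis darts_def mem_Sigma_iff UNIV_I)
  \<comment> \<open>Positivity provides some inward overdart at \<open>c\<close>. The other overdart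
    is the opposite one and points outward, so the dart at \<open>k\<close> is the same.\<close>
  then have "k = j"
    using four_cases[of k j] assms(4,5) j regularD(4)[OF regular assms(2), of j]
      regular_over[OF regular assms(2), of j] by auto
  with j(3) have "inward K (c, k + 1)" by simp
  then interpret crossing_move K c c2 c3 k
    using link assms by unfold_locales
  show ?thesis
    unfolding assms(10-14) saddle_R
    using crossing_change_positive crossing_change_negative assms(9) by blast
qed

end
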